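(* Let $a,b$ be positive integers with $a\le b$ and let $f^{a,b}_2(x,y,z,w)=ax^2+by^2+2(z^2+zw+w^2)$. If $f^{a,b}_2$ represents $1$ and $5$ (with integer arguments), then it represents every nonnegative integer. *)

theory Defs
  imports Main
begin

definition f2 :: "int \<Rightarrow> int \<Rightarrow> int \<Rightarrow> int \<Rightarrow> int \<Rightarrow> int \<Rightarrow> int" where
  "f2 a b x y z w = a * x^2 + b * y^2 + 2 * (z^2 + z*w + w^2)"

definition represents :: "int \<Rightarrow> int \<Rightarrow> int \<Rightarrow> bool" where
  "represents a b n \<longleftrightarrow> (\<exists>x y z w. f2 a b x y z w = n)"

end

(*
  The hypotheses force a = 1 and b <= 5. The form Q = x^2 + 2 (z^2 + z w + w^2) represents every
  squarefree m that is not 5 mod 8, and if m is squarefree and 5 mod 8, then m - b y^2 is represented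
  by Q for y = 1 or y = 2.

  For Q the argument follows Ankeny's proof of the three squares theorem: a suitable ternary lattice
  gives m = R^2 + v with q v = X^2 + 3 m Y^2, and the conditions on the auxiliary integer q ensure that
  v/2 is a norm z^2 + z w + w^2. Ankeny takes q to be a prime from Dirichlet's theorem. Here q is only a
  squarefree integer all of whose odd prime factors l satisfy (-3m/l) = 1, with prescribed quadratic
  characters; it exists because the sum of (1 * xi)(n) / sqrt n over the n with these characters
  diverges, where xi is the quadratic character belonging to -3m and * is Dirichlet convolution.
*)
theory Submission
  imports Defs "HOL-Number_Theory.Number_Theory" "HOL-Analysis.Harmonic_Numbers"
    "HOL-Computational_Algebra.Squarefree"
begin

subsection \<open>Reduction of positive definite forms\<close>

text \<open>The class 5 mod 8 is a true obstruction at 2. As 2 is inert in the Eisenstein integers,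
  \<open>z^2 + z*w + w^2\<close> is never 2 mod 4, and so \<open>Q\<close> takes no value in this
  class. Hence 5 needs the variable \<open>y\<close>, which bounds \<open>b\<close>. Most primes
  take care of themselves: if p does not divide 6qm but divides v to an odd power, then -3m is a
  residue mod p because qv is a norm, m is one because m = R^2 mod p, and hence -3 is one. Only the
  primes dividing 2qm have to be arranged, and this is what the conditions on q do. The weight
  1/sqrt n is critical in both directions. Restricted to squares it gives a harmonic series, so
  divergence requires no information on the value of an L-function at 1. In a nonprincipal twist
  both factors of the convolution have bounded partial sums, and with a cutoff at N for n <= N^2 the
  tails of the hyperbola method are just bounded. One divergent sum cannot cancel against finitely
  many bounded ones.\<close>

lemma exists_centred_residue:
  fixes a b :: int assumes "a > 0"
  shows "\<exists>k. \<bar>2 * (b + k * a)\<bar> \<le> a"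
proof -
  define k where "k = - ((2 * b + a) div (2 * a))"
  have "2 * b + a = 2 * a * ((2 * b + a) div (2 * a)) + (2 * b + a) mod (2 * a)"
    by simp
  moreover have "0 \<le> (2 * b + a) mod (2 * a)" "(2 * b + a) mod (2 * a) < 2 * a"
    using assms by auto
  ultimately have "\<bar>2 * (b + k * a)\<bar> \<le> a"
    by (simp add: k_def algebra_simps)
  thus ?thesis by blast
qed

text \<open>Gauss reduction as a descent on the leading coefficient: translate until |2B| <= A, then
  swap if the last coefficient is smaller. At the end 4 B^2 <= A^2 <= A C, whence the factor 4/3.
  The whole unimodular matrix is returned because the ternary reduction has to extend the short
  vector to a basis.\<close>

lemma binary_form_reduction:
  fixes A B C :: int
  assumes "A > 0" "A * C - B\<^sup>2 > 0"
  shows "\<exists>p q r s. p * s - q * r = 1 \<and> A * p\<^sup>2 + 2 * B * p * r + C * r\<^sup>2 > 0 \<and>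
           3 * (A * p\<^sup>2 + 2 * B * p * r + C * r\<^sup>2)\<^sup>2 \<le> 4 * (A * C - B\<^sup>2)"
  using assms
proof (induction "nat A" arbitrary: A B C rule: less_induct)
  case less
  obtain k where k: "\<bar>2 * (B + k * A)\<bar> \<le> A"
    using exists_centred_residue less.prems by blast
  define B1 where "B1 = B + k * A"
  define C1 where "C1 = A * k\<^sup>2 + 2 * B * k + C"
  have D: "A * C1 - B1\<^sup>2 = A * C - B\<^sup>2"
    by (simp add: B1_def C1_def power2_eq_square algebra_simps)
  have B1: "4 * B1\<^sup>2 \<le> A\<^sup>2"
    using k power_mono[of "\<bar>2 * B1\<bar>" A 2] unfolding B1_def[symmetric]
    by (simp add: power_mult_distrib)
  have C1: "C1 > 0"
    using D less.prems by (smt (verit) zero_le_power2 zero_less_mult_pos)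
  show ?case
  proof (cases "C1 \<ge> A")
    case True
    hence "A\<^sup>2 \<le> A * C1"
      using less.prems by (simp add: power2_eq_square)
    hence "3 * A\<^sup>2 \<le> 4 * (A * C1 - B1\<^sup>2)"
      using B1 by (simp add: right_diff_distrib)
    hence "3 * A\<^sup>2 \<le> 4 * (A * C - B\<^sup>2)"
      by (simp only: D)
    thus ?thesis
      using less.prems by (intro exI[of _ 1] exI[of _ 0]) auto
  next
    case False
    have "nat C1 < nat A" "C1 * A - B1\<^sup>2 > 0"
      using False C1 D less.prems by (auto simp: mult.commute)
    from less.hyps[OF this(1) C1 this(2)] obtain p q r s where h:
      "p * s - q * r = 1" "C1 * p\<^sup>2 + 2 * B1 * p * r + A * r\<^sup>2 > 0"
      "3 * (C1 * p\<^sup>2 + 2 * B1 * p * r + A * r\<^sup>2)\<^sup>2 \<le> 4 * (C1 * A - B1\<^sup>2)"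
      by blast
    have eq: "A * (k * p + r)\<^sup>2 + 2 * B * (k * p + r) * p + C * p\<^sup>2
          = C1 * p\<^sup>2 + 2 * B1 * p * r + A * r\<^sup>2"
      by (simp add: B1_def C1_def power2_eq_square algebra_simps)
    \<comment> \<open>The swap reverses orientation, so the second column is negated to keep the
      determinant 1.\<close>
    have "(k * p + r) * (- q) - (- (k * q + s)) * p = 1"
      using h(1) by (simp add: algebra_simps)
    moreover have "A * (k * p + r)\<^sup>2 + 2 * B * (k * p + r) * p + C * p\<^sup>2 > 0"
      "3 * (A * (k * p + r)\<^sup>2 + 2 * B * (k * p + r) * p + C * p\<^sup>2)\<^sup>2 \<le> 4 * (A * C - B\<^sup>2)"
      unfolding eq using h(2,3) D by (simp_all add: mult.commute)
    ultimately show ?thesis by blast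
  qed
qed

section \<open>Positive definite ternary forms and Hermite's bound\<close>

definition ternary_form :: "int \<Rightarrow> int \<Rightarrow> int \<Rightarrow> int \<Rightarrow> int \<Rightarrow> int \<Rightarrow> int \<Rightarrow> int \<Rightarrow> int \<Rightarrow> int" where
  "ternary_form a b c d e g x y z =
     a * x\<^sup>2 + b * y\<^sup>2 + c * z\<^sup>2 + 2 * d * x * y + 2 * e * x * z + 2 * g * y * z"

text \<open>The determinant of the Gram matrix with rows (a, d, e), (d, b, g), (e, g, c), which is
  integral thanks to the factors 2 in \<open>ternary_form\<close>.\<close>

definition ternary_det :: "int \<Rightarrow> int \<Rightarrow> int \<Rightarrow> int \<Rightarrow> int \<Rightarrow> int \<Rightarrow> int" where
  "ternary_det a b c d e g = a * b * c + 2 * d * e * g - a * g\<^sup>2 - b * e\<^sup>2 - c * d\<^sup>2"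

text \<open>Completing the square twice: multiplied by \<open>a\<close> and then by
  \<open>A\<close>, the form becomes a combination of three squares with positive coefficients,
  whose vanishing forces z, y and x to vanish in this order.\<close>

lemma ternary_form_pos:
  assumes "a > 0" "a * b - d\<^sup>2 > 0" "ternary_det a b c d e g > 0" "(x, y, z) \<noteq> (0, 0, 0)"
  shows "ternary_form a b c d e g x y z > 0"
proof (rule ccontr)
  define A B C where "A = a * b - d\<^sup>2" and "B = a * g - d * e" and "C = a * c - e\<^sup>2"
  assume "\<not> ?thesis"
  hence np: "a * ternary_form a b c d e g x y z \<le> 0"
    using assms(1) by (simp add: mult_nonneg_nonpos)
  have "a * ternary_form a b c d e g x y z
      = (a * x + d * y + e * z)\<^sup>2 + (A * y\<^sup>2 + 2 * B * y * z + C * z\<^sup>2)"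
    by (simp add: ternary_form_def A_def B_def C_def power2_eq_square algebra_simps)
  hence 1: "A * (a * ternary_form a b c d e g x y z)
      = A * (a * x + d * y + e * z)\<^sup>2 + (A * y + B * z)\<^sup>2 + a * ternary_det a b c d e g * z\<^sup>2"
    by (simp add: ternary_det_def A_def B_def C_def power2_eq_square algebra_simps)
  have A: "A > 0" and aD: "a * ternary_det a b c d e g > 0"
    using assms by (auto simp: A_def)
  have "A * (a * ternary_form a b c d e g x y z) \<le> 0"
    using np A by (simp add: mult_nonneg_nonpos)
  moreover have "A * (a * x + d * y + e * z)\<^sup>2 \<ge> 0" "(A * y + B * z)\<^sup>2 \<ge> 0"
      "a * ternary_det a b c d e g * z\<^sup>2 \<ge> 0"
    using A aD by auto
  ultimately have "A * (a * x + d * y + e * z)\<^sup>2 = 0" "(A * y + B * z)\<^sup>2 = 0"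
      "a * ternary_det a b c d e g * z\<^sup>2 = 0"
    using 1 by linarith+
  hence "x = 0 \<and> y = 0 \<and> z = 0"
    using A aD assms(1) by auto
  thus False using assms(4) by auto
qed

text \<open>Here \<open>A\<close> is the leading 2 by 2 minor of a reduced form and \<open>d\<close>
  its determinant. Eliminating \<open>A\<close> gives a <= (4/3) d^(1/3).\<close>

lemma ternary_form_bound_aux:
  fixes a A d :: int
  assumes "a > 0" "3 * a\<^sup>2 \<le> 4 * A" "3 * A\<^sup>2 \<le> 4 * (a * d)"
  shows "27 * a ^ 3 \<le> 64 * d"
proof -
  have "(3 * a\<^sup>2)\<^sup>2 \<le> (4 * A)\<^sup>2"
    using assms(2) by (intro power_mono) auto
  hence "27 * a ^ 3 * a \<le> 64 * d * a"
    using assms(3) by (simp add: power2_eq_square power3_eq_cube algebra_simps)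
  thus ?thesis using assms(1) by simp
qed

text \<open>Completing the square turns \<open>a\<close> times the form into a square plus a binary
  form in y, z of determinant \<open>a\<close> times the ternary one. Reducing the latter and
  translating along the first basis vector leaves either a form that meets the bound at that vector,
  or a smaller diagonal entry \<open>b1\<close> with which the descent continues.\<close>

lemma ternary_form_Hermite:
  assumes "a > 0" "a * b - d\<^sup>2 > 0" "ternary_det a b c d e g > 0"
  shows "\<exists>x y z. (x, y, z) \<noteq> (0, 0, 0) \<and>
           27 * ternary_form a b c d e g x y z ^ 3 \<le> 64 * ternary_det a b c d e g"
  using assms
proof (induction "nat a" arbitrary: a b c d e g rule: less_induct)
  case less
  define A B C where "A = a * b - d\<^sup>2" and "B = a * g - d * e" and "C = a * c - e\<^sup>2"
  define D where "D = ternary_det a b c d e g"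
  have AD: "A * C - B\<^sup>2 = a * D"
    by (simp add: A_def B_def C_def D_def ternary_det_def power2_eq_square algebra_simps)
  have "A > 0" "A * C - B\<^sup>2 > 0"
    unfolding AD using less.prems by (auto simp: D_def A_def)
  from binary_form_reduction[OF this] obtain p q r s where h:
    "p * s - q * r = 1" "A * p\<^sup>2 + 2 * B * p * r + C * r\<^sup>2 > 0"
    "3 * (A * p\<^sup>2 + 2 * B * p * r + C * r\<^sup>2)\<^sup>2 \<le> 4 * (a * D)"
    unfolding AD by blast
  define A' where "A' = A * p\<^sup>2 + 2 * B * p * r + C * r\<^sup>2"
  obtain k where k: "\<bar>2 * ((d * p + e * r) + k * a)\<bar> \<le> a"
    using exists_centred_residue less.prems by blast
  \<comment> \<open>The Gram entries for the basis (k, p, r), (1, 0, 0), (0, q, s), with diagonal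
    \<open>b1\<close>, \<open>a\<close>, \<open>c1\<close>. In this order a smaller
    \<open>b1\<close> becomes the leading coefficient.\<close>
  define d1 where "d1 = (d * p + e * r) + k * a"
  define b1 where "b1 = ternary_form a b c d e g k p r"
  define c1 where "c1 = ternary_form a b c d e g 0 q s"
  define e1 where "e1 = d * q + e * s"
  define g1 where "g1 = k * (d * q + e * s) + p * (b * q + g * s) + r * (g * q + c * s)"
  have A': "a * b1 - d1\<^sup>2 = A'"
    by (simp add: b1_def d1_def A'_def ternary_form_def A_def B_def C_def power2_eq_square
        algebra_simps)
  have "4 * d1\<^sup>2 \<le> a\<^sup>2"
    using k power_mono[of "\<bar>2 * d1\<bar>" a 2] unfolding d1_def[symmetric]
    by (simp add: power_mult_distrib)
  show ?case
  proof (cases "b1 \<ge> a")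
    case True
    hence "a\<^sup>2 \<le> a * b1"
      using less.prems by (simp add: power2_eq_square)
    hence "3 * a\<^sup>2 \<le> 4 * A'"
      using A' \<open>4 * d1\<^sup>2 \<le> a\<^sup>2\<close> by linarith
    hence "27 * a ^ 3 \<le> 64 * D"
      using ternary_form_bound_aux[of a A' D] h(3) less.prems by (simp add: A'_def)
    thus ?thesis
      by (intro exI[of _ 1] exI[of _ 0]) (auto simp: ternary_form_def D_def)
  next
    case False
    have "b1 > 0"
      unfolding b1_def
      by (rule ternary_form_pos) (use less.prems h(1) in auto)
    have "a * ternary_det b1 a c1 d1 g1 e1 = (A * C - B\<^sup>2) * (p * s - q * r)\<^sup>2"
      by (simp add: ternary_det_def b1_def c1_def d1_def g1_def e1_def ternary_form_def
          A_def B_def C_def power2_eq_square algebra_simps)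
    hence D1: "ternary_det b1 a c1 d1 g1 e1 = D"
      using h(1) AD less.prems by simp
    have "nat b1 < nat a" "b1 * a - d1\<^sup>2 > 0" "ternary_det b1 a c1 d1 g1 e1 > 0"
      using False \<open>b1 > 0\<close> A' h(2) less.prems by (auto simp: D1 D_def A'_def mult.commute)
    from less.hyps[OF this(1) \<open>b1 > 0\<close> this(2,3)] obtain x y z where
      xyz: "(x, y, z) \<noteq> (0, 0, 0)" "27 * ternary_form b1 a c1 d1 g1 e1 x y z ^ 3 \<le> 64 * D"
      unfolding D1 by blast
    have eq: "ternary_form a b c d e g (k * x + y) (p * x + q * z) (r * x + s * z)
        = ternary_form b1 a c1 d1 g1 e1 x y z"
      by (simp add: ternary_form_def b1_def c1_def d1_def g1_def e1_def power2_eq_square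
          algebra_simps)
    have "(k * x + y, p * x + q * z, r * x + s * z) \<noteq> (0, 0, 0)"
    proof
      assume *: "(k * x + y, p * x + q * z, r * x + s * z) = (0, 0, 0)"
      have "x = (p * s - q * r) * x" "z = (p * s - q * r) * z"
        by (simp_all add: h(1))
      moreover have "(p * s - q * r) * x = s * (p * x + q * z) - q * (r * x + s * z)"
          "(p * s - q * r) * z = p * (r * x + s * z) - r * (p * x + q * z)"
        by (simp_all add: algebra_simps)
      ultimately have "x = 0" "z = 0" using * by auto
      thus False using * xyz(1) by auto
    qed
    thus ?thesis
      using xyz(2) eq D_def by metis
  qed
qed

subsection \<open>The norm form $z^2+zw+w^2$\<close>

definition loeschian :: "int \<Rightarrow> bool" where
  "loeschian n \<longleftrightarrow> (\<exists>z w. n = z\<^sup>2 + z * w + w\<^sup>2)"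

text \<open>The coordinates are those of the product of the Eisenstein integers z - w omega and u -
  v omega, where omega^2 + omega + 1 = 0.\<close>

lemma loeschian_mult:
  assumes "loeschian m" "loeschian n"
  shows "loeschian (m * n)"
proof -
  obtain z w u v where "m = z\<^sup>2 + z * w + w\<^sup>2" "n = u\<^sup>2 + u * v + v\<^sup>2"
    using assms by (auto simp: loeschian_def)
  hence "m * n = (z * u - w * v)\<^sup>2 + (z * u - w * v) * (z * v + w * u + w * v)
      + (z * v + w * u + w * v)\<^sup>2"
    by (simp add: power2_eq_square algebra_simps)
  thus ?thesis unfolding loeschian_def by blast
qed

lemma loeschian_square: "loeschian (k\<^sup>2)"
  unfolding loeschian_def by (rule exI[of _ k], rule exI[of _ 0]) simp

text \<open>If c is a root of c^2 + c + 1 modulo p, the norm is divisible by p on the sublattice of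
  the pairs (x p + c y, y), which has index p. Reduction finds there a positive norm that is at most
  p.\<close>

lemma loeschian_prime:
  fixes p :: int
  assumes "prime p" "odd p" "QuadRes p (-3)"
  shows "loeschian p"
proof -
  obtain s0 where s0: "[s0\<^sup>2 = -3] (mod p)"
    using assms(3) by (auto simp: QuadRes_def)
  \<comment> \<open>Writing s = 2c + 1 takes an odd root; one of \<open>s0\<close> and
    \<open>s0 + p\<close> is odd.\<close>
  obtain s where s: "[s\<^sup>2 = -3] (mod p)" "odd s"
  proof (cases "odd s0")
    case True
    thus ?thesis using s0 that by blast
  next
    case False
    have "[(s0 + p)\<^sup>2 = s0\<^sup>2] (mod p)"
      by (intro cong_pow) (simp add: cong_def)
    hence "[(s0 + p)\<^sup>2 = -3] (mod p)" using s0 cong_trans by blast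
    moreover have "odd (s0 + p)" using False assms(2) by simp
    ultimately show ?thesis using that by blast
  qed
  obtain c where c: "s = 2 * c + 1"
    using s(2) by (rule oddE)
  have "p dvd 4 * (c\<^sup>2 + c + 1)"
    using s(1) unfolding c cong_iff_dvd_diff by (simp add: power2_eq_square algebra_simps)
  moreover have "coprime p 4"
    using assms(2) coprime_power_right_iff[of p 2 2] by (simp add: coprime_right_2_iff_odd)
  ultimately have pc: "p dvd c\<^sup>2 + c + 1"
    using coprime_dvd_mult_right_iff by blast
  have p0: "p > 0" using assms(1) prime_gt_0_int by simp
  \<comment> \<open>The coefficients belong to 2N, as N itself has an odd cross coefficient. With
    determinant 3 p^2 the reduction bound reads N <= p.\<close>
  define A B C where "A = 2 * p\<^sup>2" and "B = p * (2 * c + 1)" and "C = 2 * (c\<^sup>2 + c + 1)"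
  have D: "A * C - B\<^sup>2 = 3 * p\<^sup>2"
    by (simp add: A_def B_def C_def power2_eq_square algebra_simps)
  have "A > 0" "A * C - B\<^sup>2 > 0" unfolding D using p0 by (auto simp: A_def)
  from binary_form_reduction[OF this] obtain x u y v where h: "x * v - u * y = 1"
    "A * x\<^sup>2 + 2 * B * x * y + C * y\<^sup>2 > 0"
    "3 * (A * x\<^sup>2 + 2 * B * x * y + C * y\<^sup>2)\<^sup>2 \<le> 4 * (3 * p\<^sup>2)"
    unfolding D by blast
  define N where "N = (x * p + c * y)\<^sup>2 + (x * p + c * y) * y + y\<^sup>2"
  have N: "A * x\<^sup>2 + 2 * B * x * y + C * y\<^sup>2 = 2 * N"
    by (simp add: A_def B_def C_def N_def power2_eq_square algebra_simps)
  have "N > 0" using h(2) unfolding N by simp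
  have "N\<^sup>2 \<le> p\<^sup>2" using h(3) unfolding N by (simp add: power_mult_distrib)
  hence "N \<le> p" using p0 by (rule_tac power2_le_imp_le) auto
  have "N = p * (x\<^sup>2 * p + 2 * c * x * y + x * y) + (c\<^sup>2 + c + 1) * y\<^sup>2"
    by (simp add: N_def power2_eq_square algebra_simps)
  hence "p dvd N" using pc by simp
  hence "N = p" using \<open>N > 0\<close> \<open>N \<le> p\<close> zdvd_imp_le by fastforce
  thus ?thesis unfolding loeschian_def N_def by metis
qed

lemma loeschianI:
  fixes n :: nat
  assumes "n > 0"
    and "\<And>p. prime p \<Longrightarrow> odd (multiplicity p n) \<Longrightarrow> loeschian (int p)"
  shows "loeschian (int n)"
proof -
  have "loeschian (int (\<Prod>p\<in>A. p ^ multiplicity p n))" if "A \<subseteq> prime_factors n" for A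
  proof -
    have "finite A" using that finite_subset by blast
    thus ?thesis using that
    proof (induction A)
      case empty
      show ?case using loeschian_square[of 1] by simp
    next
      case (insert p A)
      have "loeschian (int p ^ multiplicity p n)"
      proof (cases "even (multiplicity p n)")
        case True
        then obtain k where "multiplicity p n = 2 * k" by blast
        thus ?thesis using loeschian_square[of "int p ^ k"]
          by (simp add: power_mult[symmetric] mult.commute)
      next
        case False
        then obtain k where k: "multiplicity p n = 2 * k + 1" by (rule oddE)
        have "loeschian (int p)" using assms(2) False insert.prems by auto
        hence "loeschian (int p * (int p ^ k)\<^sup>2)"
          using loeschian_mult loeschian_square by blast
        thus ?thesis unfolding k by (simp add: power_mult[symmetric] mult.commute)
      qed
      thus ?case using insert by (simp add: loeschian_mult)
    qed
  qed
  from this[of "prime_factors n"] show ?thesis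
    using prime_factorization_nat[of n] assms(1) by simp
qed

subsection \<open>Weighted sums over the hyperbola\<close>

text \<open>Abel summation, uniform in the upper end \<open>n\<close>.\<close>

lemma sum_mult_decreasing_bound:
  fixes a w :: "nat \<Rightarrow> real"
  assumes bound: "\<And>n. \<bar>\<Sum>i\<in>{m<..n}. a i\<bar> \<le> K"
    and dec: "\<And>i. i > m \<Longrightarrow> w (Suc i) \<le> w i" and nonneg: "\<And>i. i > m \<Longrightarrow> w i \<ge> 0"
  shows "\<bar>\<Sum>i\<in>{m<..n}. a i * w i\<bar> \<le> K * w (Suc m)"
proof (cases "n \<ge> Suc m")
  case False
  have "K \<ge> 0" using bound[of m] by simp
  thus ?thesis using False nonneg[of "Suc m"] by simp
next
  case True
  \<comment> \<open>With the boundary term split off, the bound telescopes along the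
    induction.\<close>
  have "\<bar>(\<Sum>i\<in>{m<..n}. a i * w i) - (\<Sum>i\<in>{m<..n}. a i) * w n\<bar> \<le> K * (w (Suc m) - w n)"
    using True
  proof (induction n rule: dec_induct)
    case base
    have "{m<..Suc m} = {Suc m}" by auto
    thus ?case by simp
  next
    case (step n)
    have "{m<..Suc n} = insert (Suc n) {m<..n}" using step.hyps by auto
    hence eq: "(\<Sum>i\<in>{m<..Suc n}. f i) = f (Suc n) + (\<Sum>i\<in>{m<..n}. f i)" for f :: "nat \<Rightarrow> real"
      by simp
    have "\<bar>(\<Sum>i\<in>{m<..n}. a i) * (w n - w (Suc n))\<bar> \<le> K * (w n - w (Suc n))"
      unfolding abs_mult using bound[of n] dec[of n] step.hyps by (intro mult_mono) auto
    moreover have "(\<Sum>i\<in>{m<..Suc n}. a i * w i) - (\<Sum>i\<in>{m<..Suc n}. a i) * w (Suc n)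
        = ((\<Sum>i\<in>{m<..n}. a i * w i) - (\<Sum>i\<in>{m<..n}. a i) * w n)
          + (\<Sum>i\<in>{m<..n}. a i) * (w n - w (Suc n))"
      unfolding eq by (simp add: algebra_simps)
    moreover have "K * (w (Suc m) - w (Suc n)) = K * (w (Suc m) - w n) + K * (w n - w (Suc n))"
      by (simp add: algebra_simps)
    ultimately show ?case using step.IH by linarith
  qed
  moreover have "\<bar>(\<Sum>i\<in>{m<..n}. a i) * w n\<bar> \<le> K * w n"
    unfolding abs_mult using bound[of n] nonneg[of n] True by (intro mult_mono) auto
  moreover have "K * w (Suc m) = K * (w (Suc m) - w n) + K * w n"
    by (simp add: algebra_simps)
  ultimately show ?thesis by linarith
qed

text \<open>Telescoping: expanding the square of sqrt (n+1) - sqrt n shows that this difference is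
  at least 1 / (2 sqrt (n+1)).\<close>

lemma sum_inverse_sqrt_le: "(\<Sum>d\<in>{0<..n}. 1 / sqrt (real d)) \<le> 2 * sqrt (real n)"
proof (induction n)
  case (Suc n)
  have "{0<..Suc n} = insert (Suc n) {0<..n}" by auto
  moreover have "1 / sqrt (real (Suc n)) \<le> 2 * (sqrt (real (Suc n)) - sqrt (real n))"
  proof -
    have "2 * (sqrt (real (Suc n)) - sqrt (real n)) * sqrt (real (Suc n)) - 1
        = (sqrt (real (Suc n)) - sqrt (real n))\<^sup>2"
      by (simp add: power2_eq_square algebra_simps)
    hence "1 \<le> 2 * (sqrt (real (Suc n)) - sqrt (real n)) * sqrt (real (Suc n))"
      by (smt (verit) zero_le_power2)
    thus ?thesis by (simp add: divide_le_eq)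
  qed
  ultimately show ?case using Suc by simp
qed simp

text \<open>By Abel summation each inner sum is at most K / sqrt (N+1), whatever its upper end
  \<open>f d\<close>; the outer weights add up to at most 2 sqrt N, and the powers of N
  cancel.\<close>

lemma sum_hyperbola_tail_bound:
  fixes a b :: "nat \<Rightarrow> real"
  assumes "\<And>i. \<bar>a i\<bar> \<le> 1" and b: "\<And>m n. \<bar>\<Sum>i\<in>{m<..n}. b i\<bar> \<le> K"
  shows "\<bar>\<Sum>d\<in>{0<..N}. \<Sum>e\<in>{N<..f d}. (a d / sqrt d) * (b e / sqrt e)\<bar> \<le> 2 * K"
proof -
  have K: "K \<ge> 0" using b[of 0 0] by simp
  have inner: "\<bar>\<Sum>e\<in>{N<..f d}. b e / sqrt e\<bar> \<le> K / sqrt (Suc N)" for d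
    using sum_mult_decreasing_bound[where m=N and a=b and K=K and w="\<lambda>e. 1 / sqrt e" and n="f d"] b
    by (auto simp: frac_le)
  have "\<bar>\<Sum>d\<in>{0<..N}. \<Sum>e\<in>{N<..f d}. (a d / sqrt d) * (b e / sqrt e)\<bar>
      \<le> (\<Sum>d\<in>{0<..N}. \<bar>a d / sqrt d\<bar> * \<bar>\<Sum>e\<in>{N<..f d}. b e / sqrt e\<bar>)"
    unfolding sum_distrib_left[symmetric] abs_mult[symmetric] by (rule sum_abs)
  also have "\<dots> \<le> (\<Sum>d\<in>{0<..N}. (1 / sqrt d) * (K / sqrt (Suc N)))"
    using assms(1) inner by (intro sum_mono mult_mono) (auto simp: divide_right_mono)
  also have "\<dots> = (\<Sum>d\<in>{0<..N}. 1 / sqrt d) * (K / sqrt (Suc N))"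
    by (rule sum_distrib_right[symmetric])
  also have "\<dots> \<le> (2 * sqrt N) * (K / sqrt (Suc N))"
    using sum_inverse_sqrt_le K by (intro mult_right_mono) auto
  also have "\<dots> = 2 * K * (sqrt N / sqrt (Suc N))"
    by simp
  also have "\<dots> \<le> 2 * K * 1"
    using K by (intro mult_left_mono) auto
  finally show ?thesis by simp
qed

text \<open>Dirichlet's hyperbola method. The square part is a product of two Abel sums, hence at
  most K^2, and each of the two arms is at most 2K.\<close>

lemma sum_hyperbola_bound:
  fixes a b :: "nat \<Rightarrow> real"
  assumes a1: "\<And>i. \<bar>a i\<bar> \<le> 1" and b1: "\<And>i. \<bar>b i\<bar> \<le> 1"
    and aK: "\<And>m n. \<bar>\<Sum>i\<in>{m<..n}. a i\<bar> \<le> K" and bK: "\<And>m n. \<bar>\<Sum>i\<in>{m<..n}. b i\<bar> \<le> K"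
  shows "\<bar>\<Sum>n\<in>{0<..N\<^sup>2}. \<Sum>d | d dvd n. a d * b (n div d) / sqrt n\<bar> \<le> K\<^sup>2 + 4 * K"
proof -
  define h where "h = (\<lambda>(d, e). (a d / sqrt (real d)) * (b e / sqrt (real e)))"
  define P where "P = {(d, e). 0 < d \<and> 0 < e \<and> d * e \<le> N\<^sup>2}"
  \<comment> \<open>\<open>P1\<close> is the square under the hyperbola, \<open>P2\<close> and
    \<open>P3\<close> are its arms. They exhaust \<open>P\<close> because no pair in it has both
    coordinates above N.\<close>
  define P1 where "P1 = {0<..N} \<times> {0<..N}"
  define P2 where "P2 = Sigma {0<..N} (\<lambda>d. {N<..N\<^sup>2 div d})"
  define P3 where "P3 = {(d, e). (e, d) \<in> P2}"
  have K: "K \<ge> 0" using aK[of 0 0] by simp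
  have "(\<Sum>n\<in>{0<..N\<^sup>2}. \<Sum>d | d dvd n. a d * b (n div d) / sqrt n)
      = (\<Sum>(n, d)\<in>Sigma {0<..N\<^sup>2} (\<lambda>n. {d. d dvd n}). a d * b (n div d) / sqrt n)"
    by (rule sum.Sigma) auto
  also have "\<dots> = sum h P"
    by (rule sum.reindex_bij_witness[of _ "\<lambda>(d, e). (d * e, d)" "\<lambda>(n, d). (d, n div d)"])
       (auto simp: P_def h_def real_sqrt_mult[symmetric] simp flip: of_nat_mult
             elim!: dvdE)
  also have "P = P1 \<union> P2 \<union> P3"
  proof -
    have small: "d \<le> N \<or> e \<le> N" if "d * e \<le> N\<^sup>2" for d e
    proof (rule ccontr)
      assume "\<not> ?thesis"
      hence "Suc N * Suc N \<le> d * e" by (intro mult_mono) auto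
      thus False using that by (simp add: power2_eq_square)
    qed
    have prod: "d * e \<le> N\<^sup>2" if "d \<le> N" "e \<le> N" for d e
      unfolding power2_eq_square using that by (intro mult_mono) auto
    have div: "d * e \<le> N\<^sup>2 \<longleftrightarrow> e \<le> N\<^sup>2 div d" if "d > 0" for d e
      using that by (simp add: less_eq_div_iff_mult_less_eq mult.commute)
    have "(d, e) \<in> P \<longleftrightarrow> (d, e) \<in> P1 \<union> P2 \<union> P3" for d e
    proof (cases "d > 0 \<and> e > 0")
      case True
      hence "(d, e) \<in> P2 \<longleftrightarrow> d \<le> N \<and> N < e \<and> d * e \<le> N\<^sup>2"
        "(d, e) \<in> P3 \<longleftrightarrow> e \<le> N \<and> N < d \<and> d * e \<le> N\<^sup>2"
        using div[of d e] div[of e d] by (auto simp: P2_def P3_def mult.commute)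
      moreover have "(d, e) \<in> P1 \<longleftrightarrow> d \<le> N \<and> e \<le> N" "(d, e) \<in> P \<longleftrightarrow> d * e \<le> N\<^sup>2"
        using True by (auto simp: P1_def P_def)
      ultimately show ?thesis using small[of d e] prod[of d e] by (auto simp: not_le)
    qed (auto simp: P_def P1_def P2_def P3_def)
    thus ?thesis by auto
  qed
  also have "sum h (P1 \<union> P2 \<union> P3) = sum h P1 + sum h P2 + sum h P3"
  proof -
    have fin: "finite P1" "finite P2" "finite P3"
    proof -
      show "finite P1" "finite P2" by (auto simp: P1_def P2_def)
      moreover have "P3 = prod.swap ` P2" unfolding P3_def by force
      ultimately show "finite P3" by simp
    qed
    have "P1 \<inter> P2 = {}" "(P1 \<union> P2) \<inter> P3 = {}"
      by (auto simp: P1_def P2_def P3_def)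
    thus ?thesis using fin by (simp add: sum.union_disjoint)
  qed
  also have "sum h P1 = (\<Sum>d\<in>{0<..N}. a d * (1 / sqrt d)) * (\<Sum>e\<in>{0<..N}. b e * (1 / sqrt e))"
  proof -
    have "sum h P1 = (\<Sum>d\<in>{0<..N}. \<Sum>e\<in>{0<..N}. h (d, e))"
      unfolding P1_def by (simp add: sum.cartesian_product)
    also have "\<dots> = (\<Sum>d\<in>{0<..N}. \<Sum>e\<in>{0<..N}. a d * (1 / sqrt d) * (b e * (1 / sqrt e)))"
      by (simp add: h_def)
    finally show ?thesis unfolding sum_product .
  qed
  also have "sum h P2 = (\<Sum>d\<in>{0<..N}. \<Sum>e\<in>{N<..N\<^sup>2 div d}. (a d / sqrt d) * (b e / sqrt e))"
  proof -
    have "sum h P2 = (\<Sum>d\<in>{0<..N}. \<Sum>e\<in>{N<..N\<^sup>2 div d}. h (d, e))"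
      unfolding P2_def by (subst sum.Sigma) auto
    thus ?thesis by (simp only: h_def case_prod_conv)
  qed
  also have "sum h P3 = (\<Sum>d\<in>{0<..N}. \<Sum>e\<in>{N<..N\<^sup>2 div d}. (b d / sqrt d) * (a e / sqrt e))"
  proof -
    have h: "h (e, d) = (b d / sqrt d) * (a e / sqrt e)" for d e
      by (simp only: h_def case_prod_conv mult.commute)
    have "sum h P3 = (\<Sum>(d, e)\<in>P2. h (e, d))"
      by (rule sum.reindex_bij_witness[of _ prod.swap prod.swap]) (auto simp: P3_def)
    also have "\<dots> = (\<Sum>d\<in>{0<..N}. \<Sum>e\<in>{N<..N\<^sup>2 div d}. h (e, d))"
      unfolding P2_def by (subst sum.Sigma) auto
    finally show ?thesis unfolding h .
  qed
  finally have eq: "(\<Sum>n\<in>{0<..N\<^sup>2}. \<Sum>d | d dvd n. a d * b (n div d) / sqrt n)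
    = (\<Sum>d\<in>{0<..N}. a d * (1 / sqrt d)) * (\<Sum>e\<in>{0<..N}. b e * (1 / sqrt e))
      + (\<Sum>d\<in>{0<..N}. \<Sum>e\<in>{N<..N\<^sup>2 div d}. (a d / sqrt d) * (b e / sqrt e))
      + (\<Sum>d\<in>{0<..N}. \<Sum>e\<in>{N<..N\<^sup>2 div d}. (b d / sqrt d) * (a e / sqrt e))" .
  have "\<bar>\<Sum>d\<in>{0<..N}. a d * (1 / sqrt d)\<bar> \<le> K" "\<bar>\<Sum>d\<in>{0<..N}. b d * (1 / sqrt d)\<bar> \<le> K"
    using sum_mult_decreasing_bound[where m=0 and a=a and K=K and w="\<lambda>e. 1 / sqrt e" and n=N]
      sum_mult_decreasing_bound[where m=0 and a=b and K=K and w="\<lambda>e. 1 / sqrt e" and n=N] aK bK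
    by (auto simp: frac_le)
  hence "\<bar>(\<Sum>d\<in>{0<..N}. a d * (1 / sqrt d)) * (\<Sum>e\<in>{0<..N}. b e * (1 / sqrt e))\<bar> \<le> K * K"
    unfolding abs_mult using K by (intro mult_mono) auto
  moreover have "\<bar>\<Sum>d\<in>{0<..N}. \<Sum>e\<in>{N<..N\<^sup>2 div d}. (a d / sqrt d) * (b e / sqrt e)\<bar> \<le> 2 * K"
    by (rule sum_hyperbola_tail_bound[OF a1 bK])
  moreover have "\<bar>\<Sum>d\<in>{0<..N}. \<Sum>e\<in>{N<..N\<^sup>2 div d}. (b d / sqrt d) * (a e / sqrt e)\<bar> \<le> 2 * K"
    by (rule sum_hyperbola_tail_bound[OF b1 aK])
  ultimately show ?thesis
    unfolding eq power2_eq_square[of K] by linarith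
qed

subsection \<open>Real characters and their divisor sums\<close>

text \<open>Real Dirichlet characters, the principal one included. \<open>M\<close> need not be the
  conductor: all characters share one modulus, so that their products are again of this
  kind.\<close>

definition real_character :: "nat \<Rightarrow> (nat \<Rightarrow> int) \<Rightarrow> bool" where
  "real_character M \<xi> \<longleftrightarrow> (\<forall>m n. \<xi> (m * n) = \<xi> m * \<xi> n) \<and> (\<forall>n. \<xi> (n + M) = \<xi> n) \<and>
     (\<forall>n. \<xi> n = (if coprime n M then 1 else 0) \<or> \<xi> n = (if coprime n M then -1 else 0))"

lemma real_character_mult: "real_character M \<xi> \<Longrightarrow> \<xi> (m * n) = \<xi> m * \<xi> n"
  by (simp add: real_character_def)

lemma real_character_add_period: "real_character M \<xi> \<Longrightarrow> \<xi> (n + M) = \<xi> n"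
  by (simp add: real_character_def)

lemma real_character_cases: "real_character M \<xi> \<Longrightarrow> \<xi> n = -1 \<or> \<xi> n = 0 \<or> \<xi> n = 1"
  unfolding real_character_def by metis

lemma real_character_eq_0_iff: "real_character M \<xi> \<Longrightarrow> \<xi> n = 0 \<longleftrightarrow> \<not> coprime n M"
  unfolding real_character_def by (metis zero_neq_neg_one zero_neq_one)

lemma real_character_square: "real_character M \<xi> \<Longrightarrow> coprime n M \<Longrightarrow> \<xi> n * \<xi> n = 1"
  using real_character_cases[of M \<xi> n] real_character_eq_0_iff[of M \<xi> n] by auto

lemma real_character_1: "real_character M \<xi> \<Longrightarrow> \<xi> 1 = 1"
  using real_character_mult[of M \<xi> 1 1] real_character_eq_0_iff[of M \<xi> 1] by simp

text \<open>The factor \<open>of_bool\<close> makes the empty product the principal character modulo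
  M.\<close>

lemma real_character_prod:
  assumes "\<And>i. i \<in> S \<Longrightarrow> real_character M (\<psi> i)"
  shows "real_character M (\<lambda>n. of_bool (coprime n M) * (\<Prod>i\<in>S. \<psi> i n))"
proof -
  have "coprime (n + M) M \<longleftrightarrow> coprime n M" for n
    unfolding coprime_iff_gcd_eq_1 by simp
  hence trivial: "real_character M (\<lambda>n. of_bool (coprime n M))"
    by (auto simp: real_character_def)
  show ?thesis using assms
  proof (induction S rule: infinite_finite_induct)
    case (insert j S)
    hence IH: "real_character M (\<lambda>n. of_bool (coprime n M) * (\<Prod>i\<in>S. \<psi> i n))"
      and j: "real_character M (\<psi> j)" by auto
    have "of_bool (coprime n M) * (\<Prod>i\<in>insert j S. \<psi> i n)
        = \<psi> j n * (of_bool (coprime n M) * (\<Prod>i\<in>S. \<psi> i n))" for n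
      using insert.hyps by simp
    moreover have "real_character M (\<lambda>n. \<psi> j n * \<phi> n)" if "real_character M \<phi>" for \<phi>
      unfolding real_character_def
    proof (intro conjI allI)
      fix m n
      show "\<psi> j (m * n) * \<phi> (m * n) = \<psi> j m * \<phi> m * (\<psi> j n * \<phi> n)"
        using real_character_mult[OF j] real_character_mult[OF that] by simp
      show "\<psi> j (n + M) * \<phi> (n + M) = \<psi> j n * \<phi> n"
        using j that unfolding real_character_def by simp
      have "(\<psi> j n = 1 \<or> \<psi> j n = -1) \<and> (\<phi> n = 1 \<or> \<phi> n = -1)" if "coprime n M"
        using j \<open>real_character M \<phi>\<close> that unfolding real_character_def by metis
      moreover have "\<psi> j n = 0" if "\<not> coprime n M"
        using real_character_eq_0_iff[OF j] that by simp
      ultimately show "\<psi> j n * \<phi> n = (if coprime n M then 1 else 0) \<or>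
          \<psi> j n * \<phi> n = (if coprime n M then - 1 else 0)"
        by (cases "coprime n M") auto
    qed
    ultimately show ?case using IH by presburger
  qed (simp_all add: trivial)
qed

lemma real_character_mod:
  assumes "real_character M \<xi>"
  shows "\<xi> (n mod M) = \<xi> n"
proof -
  have "\<xi> (r + k * M) = \<xi> r" for r k
  proof (induction k)
    case (Suc k)
    have "r + Suc k * M = (r + k * M) + M" by simp
    hence "\<xi> (r + Suc k * M) = \<xi> ((r + k * M) + M)" by (simp only:)
    also have "\<dots> = \<xi> (r + k * M)" by (rule real_character_add_period[OF assms])
    finally show ?case using Suc by simp
  qed simp
  from this[of "n mod M" "n div M"] show ?thesis by simp
qed

text \<open>Multiplication by \<open>c\<close> permutes the residues and negates the character, so
  full periods sum to 0 and fewer than M terms remain. The arms of the hyperbola require uniformity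
  in both ends.\<close>

lemma real_character_sum_bound:
  assumes \<xi>: "real_character M \<xi>" and "M > 0" and c: "\<xi> c = -1"
  shows "\<bar>\<Sum>i\<in>{m<..n}. real_of_int (\<xi> i)\<bar> \<le> real M"
proof -
  have "coprime c M" using c real_character_eq_0_iff[OF \<xi>, of c] by auto
  have inj: "inj_on (\<lambda>i. c * i mod M) {..<M}"
  proof (rule inj_onI)
    fix x y assume "x \<in> {..<M}" "y \<in> {..<M}" "c * x mod M = c * y mod M"
    hence "[x = y] (mod M)" using \<open>coprime c M\<close> cong_mult_lcancel_nat by (simp add: cong_def)
    thus "x = y" using \<open>x \<in> _\<close> \<open>y \<in> _\<close> by (simp add: cong_def)
  qed
  have "(\<lambda>i. c * i mod M) ` {..<M} = {..<M}"
    by (rule endo_inj_surj) (use inj assms(2) in auto)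
  hence "(\<Sum>i<M. \<xi> i) = (\<Sum>i<M. \<xi> (c * i mod M))"
    using sum.reindex[OF inj, of \<xi>] by simp
  also have "\<dots> = - (\<Sum>i<M. \<xi> i)"
    by (simp add: real_character_mod[OF \<xi>] real_character_mult[OF \<xi>] c sum_negf)
  finally have zero: "(\<Sum>i<M. \<xi> i) = 0" by simp
  have period: "(\<Sum>i\<in>{m<..m + M}. \<xi> i) = 0" for m
  proof (induction m)
    case 0
    have "{0<..M} = insert M {0<..<M}" "{..<M} = insert 0 {0<..<M}" using assms(2) by auto
    thus ?case using zero real_character_mod[OF \<xi>, of M] by simp
  next
    case (Suc m)
    have "insert (Suc m) {Suc m<..Suc m + M} = insert (Suc m + M) {m<..m + M}"
      using assms(2) by auto
    hence "(\<Sum>i\<in>insert (Suc m) {Suc m<..Suc m + M}. \<xi> i)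
        = (\<Sum>i\<in>insert (Suc m + M) {m<..m + M}. \<xi> i)" by simp
    moreover have "\<xi> (Suc m + M) = \<xi> (Suc m)" by (rule real_character_add_period[OF \<xi>])
    ultimately show ?case using Suc by simp
  qed
  show ?thesis
  proof (induction "n - m" arbitrary: m rule: less_induct)
    case less
    show ?case
    proof (cases "n < m + M")
      case True
      have "\<bar>\<Sum>i\<in>{m<..n}. real_of_int (\<xi> i)\<bar> \<le> (\<Sum>i\<in>{m<..n}. \<bar>real_of_int (\<xi> i)\<bar>)"
        by (rule sum_abs)
      also have "\<dots> \<le> (\<Sum>i\<in>{m<..n}. 1)"
      proof (rule sum_mono)
        fix i show "\<bar>real_of_int (\<xi> i)\<bar> \<le> 1"
          using real_character_cases[OF \<xi>, of i] by auto
      qed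
      also have "\<dots> \<le> real M" using True by simp
      finally show ?thesis .
    next
      case False
      hence "{m<..n} = {m<..m + M} \<union> {m + M<..n}" by auto
      moreover have "{m<..m + M} \<inter> {m + M<..n} = {}" by auto
      ultimately have "(\<Sum>i\<in>{m<..n}. \<xi> i) = (\<Sum>i\<in>{m + M<..n}. \<xi> i)"
        using period[of m] by (simp add: sum.union_disjoint)
      hence "(\<Sum>i\<in>{m<..n}. real_of_int (\<xi> i)) = (\<Sum>i\<in>{m + M<..n}. real_of_int (\<xi> i))"
        by (metis of_int_sum)
      moreover have "n - (m + M) < n - m" using False assms(2) by auto
      ultimately show ?thesis using less[of "m + M"] by simp
    qed
  qed
qed

section \<open>The convolution 1 * xi: Euler factors, positivity and twists\<close>

definition divisor_sum :: "(nat \<Rightarrow> int) \<Rightarrow> nat \<Rightarrow> int" where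
  "divisor_sum \<xi> n = (\<Sum>d | d dvd n. \<xi> d)"

lemma divisor_sum_prime_power_mult:
  assumes \<xi>: "\<And>m n. \<xi> (m * n) = \<xi> m * \<xi> n" "\<xi> 1 = 1" and p: "prime p" "\<not> p dvd m"
  shows "divisor_sum \<xi> (p ^ k * m) = (\<Sum>j\<le>k. \<xi> p ^ j) * divisor_sum \<xi> m"
proof -
  have pow: "\<xi> (p ^ j) = \<xi> p ^ j" for j
    by (induction j) (use \<xi> in auto)
  have ndvd: "\<not> p dvd d" if "d dvd m" for d
    using p(2) that dvd_trans by blast
  define f where "f = (\<lambda>(j, d). p ^ j * d)"
  have inj: "inj_on f ({..k} \<times> {d. d dvd m})"
  proof (rule inj_onI, clarify)
    fix i d j e assume *: "d dvd m" "e dvd m" "f (i, d) = f (j, e)"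
    have "m \<noteq> 0" using p(2) by (intro notI) simp
    hence "d \<noteq> 0" "e \<noteq> 0" using * by auto
    have "multiplicity p (p ^ i * d) = i" "multiplicity p (p ^ j * e) = j"
      using ndvd[OF *(1)] ndvd[OF *(2)] p(1) \<open>d \<noteq> 0\<close> \<open>e \<noteq> 0\<close>
      by (simp_all add: prime_elem_multiplicity_mult_distrib not_dvd_imp_multiplicity_0)
    hence "i = j" using *(3) by (simp add: f_def)
    thus "i = j \<and> d = e" using *(3) p(1) by (auto simp: f_def)
  qed
  have "{d. d dvd p ^ k * m} = f ` ({..k} \<times> {d. d dvd m})"
  proof (intro equalityI subsetI)
    fix x assume "x \<in> {d. d dvd p ^ k * m}"
    then obtain y z where yz: "x = y * z" "y dvd p ^ k" "z dvd m"
      using division_decomp[of x "p ^ k" m] by auto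
    then obtain j where "j \<le> k" "y = p ^ j"
      using p(1) divides_primepow_nat by blast
    thus "x \<in> f ` ({..k} \<times> {d. d dvd m})"
      using yz by (auto simp: f_def intro!: image_eqI[of _ _ "(j, z)"])
  qed (auto simp: f_def intro!: mult_dvd_mono le_imp_power_dvd)
  hence "divisor_sum \<xi> (p ^ k * m) = sum (\<xi> \<circ> f) ({..k} \<times> {d. d dvd m})"
    unfolding divisor_sum_def by (simp only: sum.reindex[OF inj])
  also have "\<xi> \<circ> f = (\<lambda>(j, d). \<xi> p ^ j * \<xi> d)"
    by (auto simp: f_def \<xi>(1) pow)
  finally have "divisor_sum \<xi> (p ^ k * m) = (\<Sum>(j, d)\<in>{..k} \<times> {d. d dvd m}. \<xi> p ^ j * \<xi> d)" .
  thus ?thesis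
    by (simp add: divisor_sum_def sum_product sum.cartesian_product)
qed

text \<open>The Euler factor at p^k is k + 1, 1, or the indicator of even k, according as the
  character is 1, 0 or -1 at p. So \<open>divisor_sum\<close> is a nonnegative weight whose support
  encodes the condition on primes.\<close>

lemma divisor_sum_real_character:
  assumes \<xi>: "real_character M \<xi>" and "n > 0"
  shows "divisor_sum \<xi> n \<ge> 0 \<and>
     (divisor_sum \<xi> n > 0 \<longleftrightarrow> (\<forall>p. prime p \<and> odd (multiplicity p n) \<longrightarrow> \<xi> p \<noteq> -1))"
  using assms(2)
proof (induction n rule: less_induct)
  case (less n)
  show ?case
  proof (cases "n = 1")
    case True
    have "{d::nat. d dvd 1} = {1}" by auto
    thus ?thesis using True real_character_1[OF \<xi>] by (simp add: divisor_sum_def)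
  next
    case False
    then obtain p where p: "prime p" "p dvd n" using prime_factor_nat by blast
    define k where "k = multiplicity p n"
    obtain m where m: "n = p ^ k * m" "\<not> p dvd m"
      unfolding k_def using multiplicity_decompose'[of n p] less.prems p(1) not_prime_unit by blast
    have "k > 0" using p less.prems by (simp add: k_def prime_multiplicity_gt_zero_iff)
    have "m > 0" using m less.prems by (cases m) auto
    moreover have "m < n"
      unfolding m(1) using \<open>m > 0\<close> one_less_power[OF prime_gt_1_nat[OF p(1)] \<open>k > 0\<close>] by simp
    ultimately have IH: "divisor_sum \<xi> m \<ge> 0"
      "divisor_sum \<xi> m > 0 \<longleftrightarrow> (\<forall>p. prime p \<and> odd (multiplicity p m) \<longrightarrow> \<xi> p \<noteq> -1)"
      using less.IH by auto
    have mult: "multiplicity q n = (if q = p then k else multiplicity q m)" if "prime q" for q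
      using that p(1) \<open>m > 0\<close> unfolding m(1) k_def[symmetric]
      by (auto simp: prime_elem_multiplicity_mult_distrib multiplicity_distinct_prime_power
          not_dvd_imp_multiplicity_0 m(2))
    have m0: "multiplicity p m = 0" using m(2) by (simp add: not_dvd_imp_multiplicity_0)
    have eq: "divisor_sum \<xi> n = (\<Sum>j\<le>k. \<xi> p ^ j) * divisor_sum \<xi> m"
      unfolding m(1) using divisor_sum_prime_power_mult[of \<xi> p m k] real_character_mult[OF \<xi>]
        real_character_1[OF \<xi>] p(1) m(2) by blast
    have alt: "(\<Sum>j\<le>k. (-1::int) ^ j) = of_bool (even k)"
      by (induction k) auto
    have sign: "(\<Sum>j\<le>k. \<xi> p ^ j) \<ge> 0 \<and> ((\<Sum>j\<le>k. \<xi> p ^ j) > 0 \<longleftrightarrow> \<not> (odd k \<and> \<xi> p = -1))"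
    proof -
      consider "\<xi> p = -1" | "\<xi> p = 0" | "\<xi> p = 1" using real_character_cases[OF \<xi>] by blast
      thus ?thesis
      proof cases
        case 1
        show ?thesis unfolding 1 alt by simp
      next
        case 2
        have "(\<Sum>j\<le>k. (0::int) ^ j) = 1" by (induction k) auto
        thus ?thesis unfolding 2 by simp
      qed simp
    qed
    have "(\<forall>q. prime q \<and> odd (multiplicity q n) \<longrightarrow> \<xi> q \<noteq> -1) \<longleftrightarrow>
        \<not> (odd k \<and> \<xi> p = -1) \<and> (\<forall>q. prime q \<and> odd (multiplicity q m) \<longrightarrow> \<xi> q \<noteq> -1)"
      using mult m0 p(1) by (metis even_zero)
    thus ?thesis
      unfolding eq using IH sign by (auto simp: zero_less_mult_iff)
  qed
qed

text \<open>Pair d with n div d: the character squares to 1 at d, hence its values at n and d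
  multiply to its value at n div d.\<close>

lemma real_character_mult_divisor_sum:
  assumes \<xi>: "real_character M \<xi>" and "n > 0" "coprime n M"
  shows "\<xi> n * divisor_sum \<xi> n = divisor_sum \<xi> n"
proof -
  have "\<xi> n * divisor_sum \<xi> n = (\<Sum>d | d dvd n. \<xi> (n div d))"
    unfolding divisor_sum_def sum_distrib_left
  proof (rule sum.cong)
    fix d assume "d \<in> {d. d dvd n}"
    then obtain e where e: "n = d * e" by auto
    hence "coprime d M" using assms(3) by simp
    moreover have "d > 0" using assms(2) e by (cases d) auto
    ultimately show "\<xi> n * \<xi> d = \<xi> (n div d)"
      using real_character_square[OF \<xi>, of d] unfolding e real_character_mult[OF \<xi>]
      by (simp add: ac_simps)
  qed simp
  also have "\<dots> = divisor_sum \<xi> n"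
    unfolding divisor_sum_def using assms(2)
    by (intro sum.reindex_bij_witness[of _ "\<lambda>d. n div d" "\<lambda>d. n div d"]) auto
  finally show ?thesis .
qed

text \<open>As phi is completely multiplicative, phi times 1 * xi is the convolution of phi with phi
  xi. The numbers \<open>c\<close> and \<open>c'\<close> witness that both factors are nonprincipal,
  so the hyperbola bound applies.\<close>

lemma twisted_divisor_sum_bound:
  assumes \<phi>: "real_character M \<phi>" and \<xi>: "real_character M \<xi>" and "M > 0"
    and c: "\<phi> c = -1" and c': "\<phi> c' * \<xi> c' = -1"
  shows "\<bar>\<Sum>n\<in>{0<..N\<^sup>2}. real_of_int (\<phi> n * divisor_sum \<xi> n) / sqrt (real n)\<bar>
           \<le> (real M)\<^sup>2 + 4 * real M"
proof -
  have "(\<lambda>n. of_bool (coprime n M) * (\<Prod>i\<in>{True, False}. (if i then \<phi> else \<xi>) n))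
      = (\<lambda>n. \<phi> n * \<xi> n)"
    using real_character_eq_0_iff[OF \<phi>] by (intro ext) simp
  moreover have "real_character M (if i then \<phi> else \<xi>)" for i
    using \<phi> \<xi> by simp
  ultimately have char2: "real_character M (\<lambda>n. \<phi> n * \<xi> n)"
    using real_character_prod[of "{True, False}" M "\<lambda>i. if i then \<phi> else \<xi>"] by metis
  have le1: "\<bar>real_of_int (\<eta> n)\<bar> \<le> 1" if "real_character M \<eta>" for \<eta> n
    using real_character_cases[OF that, of n] by auto
  have "real_of_int (\<phi> n * divisor_sum \<xi> n) / sqrt (real n)
      = (\<Sum>d | d dvd n. real_of_int (\<phi> d * \<xi> d) * real_of_int (\<phi> (n div d)) / sqrt (real n))"
    if "n > 0" for n
  proof -
    have "\<phi> n * divisor_sum \<xi> n = (\<Sum>d | d dvd n. (\<phi> d * \<xi> d) * \<phi> (n div d))"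
      unfolding divisor_sum_def sum_distrib_left
    proof (rule sum.cong)
      fix d assume "d \<in> {d. d dvd n}"
      hence "\<phi> n = \<phi> d * \<phi> (n div d)"
        using real_character_mult[OF \<phi>, of d "n div d"] by simp
      thus "\<phi> n * \<xi> d = (\<phi> d * \<xi> d) * \<phi> (n div d)" by simp
    qed simp
    hence "real_of_int (\<phi> n * divisor_sum \<xi> n)
        = (\<Sum>d | d dvd n. real_of_int (\<phi> d * \<xi> d) * real_of_int (\<phi> (n div d)))"
      by (simp only: of_int_sum of_int_mult)
    thus ?thesis by (simp only: sum_divide_distrib)
  qed
  hence "(\<Sum>n\<in>{0<..N\<^sup>2}. real_of_int (\<phi> n * divisor_sum \<xi> n) / sqrt (real n))
      = (\<Sum>n\<in>{0<..N\<^sup>2}. \<Sum>d | d dvd n.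
          real_of_int (\<phi> d * \<xi> d) * real_of_int (\<phi> (n div d)) / sqrt (real n))"
    by (intro sum.cong) auto
  thus ?thesis
    using sum_hyperbola_bound[OF le1[OF char2] le1[OF \<phi>]
        real_character_sum_bound[OF char2 \<open>M > 0\<close> c'] real_character_sum_bound[OF \<phi> \<open>M > 0\<close> c]]
    by simp
qed

text \<open>By nonnegativity it is enough to keep n = (iM + 1)^2. Such n is coprime to M and a
  square, so its divisor sum is at least 1, and its weight is 1 / (iM + 1).\<close>

lemma sum_divisor_sum_ge_harm:
  assumes \<xi>: "real_character M \<xi>" and "M > 0"
  shows "harm (N div M) / M
      \<le> (\<Sum>n\<in>{0<..N\<^sup>2}. real_of_int (of_bool (coprime n M) * divisor_sum \<xi> n) / sqrt (real n))"
proof -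
  define g where "g = (\<lambda>n. real_of_int (of_bool (coprime n M) * divisor_sum \<xi> n) / sqrt (real n))"
  define s where "s = (\<lambda>i. (i * M + 1)\<^sup>2)"
  have g_nonneg: "g n \<ge> 0" if "n > 0" for n
    using divisor_sum_real_character[OF \<xi> that] by (auto simp: g_def)
  have inj: "inj_on s {..<N div M}"
    using \<open>M > 0\<close> by (auto simp: inj_on_def s_def)
  have sub: "s ` {..<N div M} \<subseteq> {0<..N\<^sup>2}"
  proof
    fix x assume "x \<in> s ` {..<N div M}"
    then obtain i where i: "i < N div M" "x = s i" by auto
    have "i * M + 1 \<le> i * M + M" using \<open>M > 0\<close> by simp
    also have "\<dots> = (i + 1) * M" by simp
    also have "\<dots> \<le> N div M * M" using i by (intro mult_right_mono) auto
    also have "\<dots> \<le> N" by simp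
    finally have "s i \<le> N\<^sup>2" unfolding s_def by (intro power_mono) auto
    moreover have "s i > 0" by (simp add: s_def)
    ultimately show "x \<in> {0<..N\<^sup>2}" using i by simp
  qed
  have g_ge: "inverse (real (Suc i)) / M \<le> g (s i)" for i
  proof -
    have "coprime (i * M + 1) M"
      by (rule coprimeI) (metis dvd_add_right_iff dvd_mult)
    hence "coprime (s i) M" by (simp add: s_def)
    have "s i > 0" by (simp add: s_def)
    moreover have "even (multiplicity p (s i))" if "prime p" for p
      using that by (simp add: s_def prime_elem_multiplicity_power_distrib)
    ultimately have "divisor_sum \<xi> (s i) > 0"
      using divisor_sum_real_character[OF \<xi>, of "s i"] by blast
    hence g: "g (s i) \<ge> 1 / sqrt (real (s i))"
      using \<open>coprime (s i) M\<close> by (simp add: g_def divide_right_mono)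
    have sqrt: "sqrt (real (s i)) = real (i * M + 1)"
      unfolding s_def of_nat_power by (rule real_sqrt_unique) auto
    have "i * M + 1 \<le> Suc i * M" using \<open>M > 0\<close> by simp
    hence "real (i * M + 1) \<le> real (Suc i) * real M" unfolding of_nat_mult[symmetric] of_nat_le_iff .
    hence "1 / (real (Suc i) * real M) \<le> 1 / real (i * M + 1)"
      by (rule frac_le[rotated 3]) (auto intro: add_pos_nonneg)
    hence "1 / (real (Suc i) * real M) \<le> g (s i)"
      using g unfolding sqrt by (rule order_trans)
    thus ?thesis by (simp only: inverse_eq_divide divide_divide_eq_left)
  qed
  have "harm (N div M) / M = (\<Sum>i<N div M. inverse (real (Suc i)) / M)"
    by (simp only: harm_altdef sum_divide_distrib)
  also have "\<dots> \<le> (\<Sum>i<N div M. g (s i))"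
    by (intro sum_mono g_ge)
  also have "\<dots> = sum g (s ` {..<N div M})"
    by (simp add: sum.reindex[OF inj])
  also have "\<dots> \<le> sum g {0<..N\<^sup>2}"
    using sub g_nonneg by (intro sum_mono2) auto
  finally show ?thesis by (simp only: g_def)
qed

text \<open>
  Were there no such $n$, expanding $\prod_{i\in I}(1+\epsilon_i\psi_i(n))$ would express a vanishing
  sum of the numbers $(1*\xi)(n)/\sqrt n$, where $\xi=\prod_{i\in J}\psi_i$, through the character
  twists of this sum. All twists are bounded except those by the principal character and by $\xi$;
  these two agree, and they diverge because $1*\xi$ is at least 1 at squares.
\<close>
lemma exists_prescribed_characters:
  fixes \<psi> :: "'i \<Rightarrow> nat \<Rightarrow> int"
  assumes "M > 0" "finite I" and \<psi>: "\<And>i. i \<in> I \<Longrightarrow> real_character M (\<psi> i)"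
    and indep: "\<And>\<epsilon>. (\<And>i. i \<in> I \<Longrightarrow> \<epsilon> i = 1 \<or> \<epsilon> i = -1) \<Longrightarrow> \<exists>c. \<forall>i\<in>I. \<psi> i c = \<epsilon> i"
    and J: "J \<subseteq> I" "J \<noteq> {}"
    and \<epsilon>: "\<And>i. i \<in> I \<Longrightarrow> \<epsilon> i = 1 \<or> \<epsilon> i = -1" "(\<Prod>i\<in>J. \<epsilon> i) = 1"
  shows "\<exists>n>0. coprime n M \<and> (\<forall>i\<in>I. \<psi> i n = \<epsilon> i) \<and>
           (\<forall>p. prime p \<and> odd (multiplicity p n) \<longrightarrow> (\<Prod>i\<in>J. \<psi> i p) = 1)"
proof (rule ccontr)
  assume contra: "\<not> ?thesis"
  define \<Psi> where "\<Psi> = (\<lambda>S n. of_bool (coprime n M) * (\<Prod>i\<in>S. \<psi> i n))"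
  have \<Psi>: "real_character M (\<Psi> S)" if "S \<subseteq> I" for S
    unfolding \<Psi>_def using that \<psi> by (intro real_character_prod) auto
  define \<xi> where "\<xi> = \<Psi> J"
  have \<xi>: "real_character M \<xi>" unfolding \<xi>_def using \<Psi> J by blast
  obtain j where j: "j \<in> J" using J by blast
  have finJ: "finite J" using J assms(2) finite_subset by blast
  \<comment> \<open>Reversing the sign at the single index k distinguishes any two index sets that
    differ at k. This yields the witnesses that the twists are nonprincipal.\<close>
  have nonprincipal: "\<exists>c. coprime c M \<and> (\<forall>i\<in>I. \<psi> i c = (if i = k then -1 else 1))" for k
  proof -
    have "\<exists>c. \<forall>i\<in>I. \<psi> i c = (if i = k then -1 else 1)" by (rule indep) auto
    then obtain c where c: "\<forall>i\<in>I. \<psi> i c = (if i = k then -1 else 1)" by blast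
    have "j \<in> I" using j J by blast
    hence "\<psi> j c \<noteq> 0" using c by auto
    hence "coprime c M" using real_character_eq_0_iff[OF \<psi>[OF \<open>j \<in> I\<close>]] by blast
    thus ?thesis using c by blast
  qed
  have prod_sign: "(\<Prod>i\<in>S. (if i = k then -1 else 1 :: int)) = (if k \<in> S then -1 else 1)"
    if "finite S" for S and k :: 'i
    using that by (simp add: prod.delta)
  have \<Psi>c: "\<exists>c. \<Psi> S c * \<Psi> T c = -1" if "S \<subseteq> I" "T \<subseteq> I" "S \<noteq> T" for S T
  proof -
    have "\<exists>k\<in>I. k \<in> S \<longleftrightarrow> k \<notin> T" using that by blast
    then obtain k where k: "k \<in> I" "k \<in> S \<longleftrightarrow> k \<notin> T" by blast
    obtain c where c: "coprime c M" "\<forall>i\<in>I. \<psi> i c = (if i = k then -1 else 1)"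
      using nonprincipal by blast
    have "\<Psi> R c = (if k \<in> R then -1 else 1)" if "R \<subseteq> I" for R
    proof -
      have "(\<Prod>i\<in>R. \<psi> i c) = (\<Prod>i\<in>R. (if i = k then -1 else 1 :: int))"
        using that c(2) by (intro prod.cong) auto
      also have "\<dots> = (if k \<in> R then -1 else 1)"
        using prod_sign finite_subset[OF that assms(2)] by blast
      finally show ?thesis using c(1) by (simp add: \<Psi>_def)
    qed
    thus ?thesis using that k(2) by (intro exI[of _ c]) auto
  qed
  define T where "T = (\<lambda>S N. \<Sum>n\<in>{0<..N\<^sup>2}. real_of_int (\<Psi> S n * divisor_sum \<xi> n) / sqrt (real n))"
  define K where "K = (real M)\<^sup>2 + 4 * real M"
  have T_bound: "\<bar>T S N\<bar> \<le> K" if S: "S \<subseteq> I" "S \<noteq> {}" "S \<noteq> J" for S N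
  proof -
    obtain c where "\<Psi> S c * \<Psi> {} c = -1" using \<Psi>c[of S "{}"] S by blast
    hence c: "\<Psi> S c = -1" by (cases "coprime c M") (auto simp: \<Psi>_def)
    obtain c' where c': "\<Psi> S c' * \<xi> c' = -1" unfolding \<xi>_def using \<Psi>c[of S J] S J by blast
    show ?thesis
      unfolding T_def K_def by (rule twisted_divisor_sum_bound[OF \<Psi>[OF S(1)] \<xi> \<open>M > 0\<close> c c'])
  qed
  have T_J: "T J N = T {} N" for N
  proof -
    have "\<Psi> J n * divisor_sum \<xi> n = \<Psi> {} n * divisor_sum \<xi> n" if "n > 0" for n
      using real_character_mult_divisor_sum[OF \<xi> that] by (cases "coprime n M") (auto simp: \<xi>_def \<Psi>_def)
    thus ?thesis unfolding T_def by (intro sum.cong) auto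
  qed
  have T_0: "T {} N \<ge> harm (N div M) / M" for N
    using sum_divisor_sum_ge_harm[OF \<xi> \<open>M > 0\<close>, of N] by (simp add: T_def \<Psi>_def)
  \<comment> \<open>For n coprime to M each factor of the product is 0 or 2. If all are 2 and the
    divisor sum is nonzero, n contradicts \<open>contra\<close>.\<close>
  have zero: "(\<Prod>i\<in>I. 1 + \<epsilon> i * \<psi> i n) * (of_bool (coprime n M) * divisor_sum \<xi> n) = 0"
    if "n > 0" for n
  proof (rule ccontr)
    assume *: "\<not> ?thesis"
    hence n: "coprime n M" "divisor_sum \<xi> n \<noteq> 0" and nz: "\<forall>i\<in>I. 1 + \<epsilon> i * \<psi> i n \<noteq> 0"
      using assms(2) by auto
    have "\<psi> i n = \<epsilon> i" if "i \<in> I" for i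
      using real_character_cases[OF \<psi>[OF that], of n] real_character_eq_0_iff[OF \<psi>[OF that]]
        n(1) \<epsilon>(1)[OF that] nz that by force
    moreover have "(\<Prod>i\<in>J. \<psi> i p) = 1" if p: "prime p" "odd (multiplicity p n)" for p
    proof -
      have "p dvd n" using p(2) not_dvd_imp_multiplicity_0[of p n] by fastforce
      hence "coprime p M" using n(1) coprime_divisors dvd_refl by blast
      moreover have "\<xi> p \<noteq> -1"
        using divisor_sum_real_character[OF \<xi> \<open>n > 0\<close>] n(2) p by force
      ultimately have "\<xi> p = 1"
        using real_character_cases[OF \<xi>, of p] real_character_eq_0_iff[OF \<xi>, of p] by auto
      thus ?thesis using \<open>coprime p M\<close> by (simp add: \<xi>_def \<Psi>_def)
    qed
    ultimately show False using contra that n(1) by blast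
  qed
  have sum_zero: "(\<Sum>S\<in>Pow I. real_of_int (\<Prod>i\<in>S. \<epsilon> i) * T S N) = 0" for N
  proof -
    have expand: "(\<Prod>i\<in>I. 1 + \<epsilon> i * \<psi> i n) = (\<Sum>S\<in>Pow I. (\<Prod>i\<in>S. \<epsilon> i) * (\<Prod>i\<in>S. \<psi> i n))" for n
      using prod_add[OF assms(2), of "\<lambda>i. \<epsilon> i * \<psi> i n" "\<lambda>_. 1"]
      by (simp add: add.commute prod.distrib)
    have eq0: "(\<Sum>S\<in>Pow I. (\<Prod>i\<in>S. \<epsilon> i) * (\<Psi> S n * divisor_sum \<xi> n)) = 0" if "n > 0" for n
      using zero[OF that] unfolding expand sum_distrib_right \<Psi>_def by (simp add: ac_simps)
    have "(\<Sum>S\<in>Pow I. real_of_int (\<Prod>i\<in>S. \<epsilon> i) * T S N)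
        = (\<Sum>n\<in>{0<..N\<^sup>2}. \<Sum>S\<in>Pow I. real_of_int ((\<Prod>i\<in>S. \<epsilon> i) * (\<Psi> S n * divisor_sum \<xi> n)) / sqrt n)"
      unfolding T_def sum_distrib_left by (subst sum.swap) simp
    also have "\<dots> = (\<Sum>n\<in>{0<..N\<^sup>2}. 0)"
    proof (rule sum.cong)
      fix n assume "n \<in> {0<..N\<^sup>2}"
      hence "n > 0" by simp
      show "(\<Sum>S\<in>Pow I. real_of_int ((\<Prod>i\<in>S. \<epsilon> i) * (\<Psi> S n * divisor_sum \<xi> n)) / sqrt n) = 0"
        unfolding sum_divide_distrib[symmetric] of_int_sum[symmetric] eq0[OF \<open>n > 0\<close>] by simp
    qed simp
    finally show ?thesis by simp
  qed
  \<comment> \<open>The terms of \<open>{}\<close> and \<open>J\<close> both have coefficient 1, the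
    latter by the hypothesis on the product of signs over \<open>J\<close>. So the two equal
    divergent sums add up instead of cancelling.\<close>
  have T_le: "2 * T {} N \<le> 2 ^ card I * K" for N
  proof -
    have "Pow I = insert {} (insert J (Pow I - {{}, J}))" using J by auto
    hence "(\<Sum>S\<in>Pow I. real_of_int (\<Prod>i\<in>S. \<epsilon> i) * T S N)
        = (\<Sum>S\<in>insert {} (insert J (Pow I - {{}, J})). real_of_int (\<Prod>i\<in>S. \<epsilon> i) * T S N)"
      by simp
    also have "\<dots> = 2 * T {} N + (\<Sum>S\<in>Pow I - {{}, J}. real_of_int (\<Prod>i\<in>S. \<epsilon> i) * T S N)"
      using assms(2) J \<epsilon>(2) T_J by (simp del: of_int_prod)
    finally have "2 * T {} N = - (\<Sum>S\<in>Pow I - {{}, J}. real_of_int (\<Prod>i\<in>S. \<epsilon> i) * T S N)"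
      using sum_zero by simp
    also have "\<dots> \<le> \<bar>\<Sum>S\<in>Pow I - {{}, J}. real_of_int (\<Prod>i\<in>S. \<epsilon> i) * T S N\<bar>"
      by linarith
    also have "\<dots> \<le> (\<Sum>S\<in>Pow I - {{}, J}. \<bar>real_of_int (\<Prod>i\<in>S. \<epsilon> i) * T S N\<bar>)"
      by (rule sum_abs)
    also have "\<dots> \<le> (\<Sum>S\<in>Pow I - {{}, J}. K)"
    proof (rule sum_mono)
      fix S assume S: "S \<in> Pow I - {{}, J}"
      have "\<bar>\<Prod>i\<in>S. \<epsilon> i\<bar> = (\<Prod>i\<in>S. 1)"
        unfolding abs_prod using S \<epsilon>(1) by (intro prod.cong) fastforce+
      hence "\<bar>real_of_int (\<Prod>i\<in>S. \<epsilon> i)\<bar> = 1" by (metis of_int_1 of_int_abs prod.neutral_const)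
      thus "\<bar>real_of_int (\<Prod>i\<in>S. \<epsilon> i) * T S N\<bar> \<le> K"
        using T_bound[of S N] S by (simp add: abs_mult del: of_int_prod)
    qed
    also have "\<dots> \<le> (\<Sum>S\<in>Pow I. K)"
      using assms(2) by (intro sum_mono2) (auto simp: K_def)
    also have "\<dots> = 2 ^ card I * K"
      using assms(2) by (simp add: card_Pow)
    finally show ?thesis .
  qed
  have "eventually (\<lambda>n. (harm n :: real) > 2 ^ card I * K * M) sequentially"
    using harm_at_top filterlim_at_top_dense by blast
  then obtain n where n: "(harm n :: real) > 2 ^ card I * K * M"
    using eventually_sequentially by auto
  have "K \<ge> 0" by (simp add: K_def)
  have "harm n / M \<le> T {} (n * M)" using T_0[of "n * M"] \<open>M > 0\<close> by simp
  also have "\<dots> \<le> 2 ^ card I * K"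
  proof -
    have "2 ^ card I * K \<ge> 0" using \<open>K \<ge> 0\<close> by simp
    thus ?thesis using T_le[of "n * M"] by linarith
  qed
  finally show False using n \<open>M > 0\<close> by (simp add: field_simps)
qed

subsection \<open>Legendre symbols\<close>

text \<open>This upgrades the congruences of Euler's criterion to equalities of signs.\<close>

lemma cong_sign_imp_eq:
  fixes x y p :: int
  assumes "[x = y] (mod p)" "p > 2" "\<bar>x\<bar> \<le> 1" "\<bar>y\<bar> \<le> 1"
  shows "x = y"
proof (rule ccontr)
  assume "x \<noteq> y"
  moreover have "p dvd \<bar>x - y\<bar>" using assms(1) by (simp add: cong_iff_dvd_diff)
  ultimately have "p \<le> \<bar>x - y\<bar>" by (intro zdvd_imp_le) auto
  thus False using assms by linarith
qed

lemma abs_Legendre_le: "\<bar>Legendre a p\<bar> \<le> 1"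
  by (simp add: Legendre_def)

lemma Legendre_mult:
  assumes "prime p" "2 < p"
  shows "Legendre (a * b) (int p) = Legendre a p * Legendre b p"
proof (rule cong_sign_imp_eq)
  have "[Legendre a p * Legendre b p = a ^ ((p - 1) div 2) * b ^ ((p - 1) div 2)] (mod int p)"
    using assms by (intro cong_mult euler_criterion)
  thus "[Legendre (a * b) p = Legendre a p * Legendre b p] (mod int p)"
    using euler_criterion[OF assms, of "a * b"] cong_trans cong_sym
    by (metis power_mult_distrib)
  show "\<bar>Legendre a p * Legendre b p\<bar> \<le> 1"
    using abs_Legendre_le[of a p] abs_Legendre_le[of b p] mult_mono[of "\<bar>Legendre a p\<bar>" 1 "\<bar>Legendre b p\<bar>" 1]
    by (simp add: abs_mult)
qed (use assms abs_Legendre_le in auto)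

lemma Legendre_cong: "[a = b] (mod p) \<Longrightarrow> Legendre a p = Legendre b p"
  by (simp add: Legendre_def QuadRes_def cong_def)

lemma Legendre_eq_0_iff: "Legendre a p = 0 \<longleftrightarrow> p dvd a"
  by (simp add: Legendre_def cong_0_iff)

lemma Legendre_eq_1_imp_QuadRes: "Legendre a p = 1 \<Longrightarrow> QuadRes p a"
  by (simp add: Legendre_def split: if_splits)

lemma Legendre_1: "p > 2 \<Longrightarrow> Legendre 1 p = 1"
  by (auto simp: Legendre_def QuadRes_def cong_0_iff intro: exI[of _ 1] dest: zdvd_imp_le)

lemma Legendre_square:
  assumes "prime p" "2 < p" "\<not> int p dvd a"
  shows "Legendre a p * Legendre a p = 1"
  using assms(3) Legendre_eq_0_iff[of a p] abs_Legendre_le[of a p]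
  by (auto simp: abs_le_iff Legendre_def)

text \<open>\<open>chi4\<close> and \<open>chi8\<close> are the characters (-1/n) and (2/n) of the
  two supplementary laws.\<close>

definition chi4 :: "nat \<Rightarrow> int" where
  "chi4 n = (if even n then 0 else if n mod 4 = 1 then 1 else -1)"

definition chi8 :: "nat \<Rightarrow> int" where
  "chi8 n = (if even n then 0 else if n mod 8 = 1 \<or> n mod 8 = 7 then 1 else -1)"

lemma Legendre_minus_1:
  assumes "prime p" "2 < p"
  shows "Legendre (-1) p = chi4 p"
proof (rule cong_sign_imp_eq)
  have "odd p" using assms prime_odd_nat by auto
  hence "(-1) ^ ((p - 1) div 2) = chi4 p"
    unfolding chi4_def minus_one_power_iff by presburger
  thus "[Legendre (-1) p = chi4 p] (mod int p)"
    using euler_criterion[OF assms, of "-1"] by simp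
qed (use assms in \<open>auto simp: abs_Legendre_le chi4_def\<close>)

lemma Legendre_2:
  assumes "prime p" "2 < p"
  shows "Legendre 2 p = chi8 p"
proof -
  have "odd p" using assms prime_odd_nat by auto
  interpret GAUSS p 2
    by standard (use assms in \<open>auto simp: cong_0_iff dest: zdvd_imp_le\<close>)
  define h where "h = (int p - 1) div 2"
  have h: "int p = 2 * h + 1" using \<open>odd p\<close> by (auto simp: h_def elim!: oddE)
  \<comment> \<open>For x <= h the number 2x is already below p, so reduction modulo p leaves it
    alone, and Gauss's lemma counts the x with 2x > h.\<close>
  have "C = (\<lambda>x. 2 * x) ` {0<..h}"
    unfolding C_def B_def A_def h_def[symmetric] image_image
    using h by (intro image_cong) (auto simp: mult.commute)
  hence "E = (\<lambda>x. 2 * x) ` {h div 2<..h}"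
    unfolding E_def h_def[symmetric] by auto
  hence "card E = card {h div 2<..h}"
    by (simp add: card_image inj_on_def)
  also have "\<dots> = nat (h - h div 2)" by simp
  finally have "Legendre 2 p = (-1) ^ nat (h - h div 2)"
    using gauss_lemma by simp
  also have "\<dots> = chi8 p"
  proof -
    have "h \<ge> 0" using h assms by linarith
    hence "even (nat (h - h div 2)) \<longleftrightarrow> even (h - h div 2)"
      by (simp add: even_nat_iff)
    also have "\<dots> \<longleftrightarrow> p mod 8 = 1 \<or> p mod 8 = 7"
    proof -
      define k where "k = int (p div 8)"
      have "int p = 8 * k + int (p mod 8)" unfolding k_def using div_mult_mod_eq[of p 8] by linarith
      moreover have "p mod 8 = 1 \<or> p mod 8 = 3 \<or> p mod 8 = 5 \<or> p mod 8 = 7"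
        using \<open>odd p\<close> by presburger
      ultimately consider "p mod 8 = 1" "h = 4 * k" | "p mod 8 = 3" "h = 4 * k + 1"
        | "p mod 8 = 5" "h = 4 * k + 2" | "p mod 8 = 7" "h = 4 * k + 3"
        using h by fastforce
      thus ?thesis by cases (simp_all, presburger+)
    qed
    finally show ?thesis
      using \<open>odd p\<close> by (simp add: minus_one_power_iff chi8_def)
  qed
  finally show ?thesis .
qed

text \<open>The law in asymmetric form: for fixed p the right side is a product of characters
  evaluated at q.\<close>

lemma Legendre_reciprocity:
  fixes p q :: nat
  assumes "prime p" "2 < p" "prime q" "2 < q" "p \<noteq> q"
  shows "Legendre p q = Legendre q p * (if p mod 4 = 3 then chi4 q else 1)"
proof -
  have "odd p" "odd q" using assms prime_odd_nat by auto
  have "(-1 :: int) ^ ((p - 1) div 2 * ((q - 1) div 2)) = (if p mod 4 = 3 then chi4 q else 1)"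
  proof -
    have "even ((p - 1) div 2) \<longleftrightarrow> p mod 4 \<noteq> 3" "even ((q - 1) div 2) \<longleftrightarrow> q mod 4 = 1"
      using \<open>odd p\<close> \<open>odd q\<close> by presburger+
    thus ?thesis using \<open>odd q\<close> by (auto simp: minus_one_power_iff chi4_def)
  qed
  hence rec: "Legendre p q * Legendre q p = (if p mod 4 = 3 then chi4 q else 1)"
    using Quadratic_Reciprocity[OF assms] by simp
  have "\<not> int p dvd int q"
    using assms primes_dvd_imp_eq by auto
  hence "Legendre q p * Legendre q p = 1"
    using Legendre_square assms by simp
  hence "Legendre p q = Legendre q p * (Legendre p q * Legendre q p)"
    by (simp add: mult.left_commute)
  thus ?thesis unfolding rec .
qed

text \<open>Otherwise squaring would be surjective on the nonzero residues, hence injective, yet 1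
  and p - 1 have the same square.\<close>

lemma exists_Legendre_minus_1:
  fixes p :: nat
  assumes "prime p" "2 < p"
  shows "\<exists>c::nat. Legendre c p = -1"
proof (rule ccontr)
  assume contra: "\<not> ?thesis"
  define f where "f = (\<lambda>x::nat. x\<^sup>2 mod p)"
  have ndvd: "\<not> p dvd x" if "x \<in> {0<..<p}" for x using that nat_dvd_not_less by auto
  have "{0<..<p} \<subseteq> f ` {0<..<p}"
  proof
    fix c assume c: "c \<in> {0<..<p}"
    have "Legendre c p \<noteq> -1" using contra by blast
    moreover have "\<not> [int c = 0] (mod int p)" using ndvd[OF c] by (simp add: cong_0_iff)
    ultimately have "QuadRes p c" by (auto simp: Legendre_def split: if_splits)
    then obtain y where y: "[y\<^sup>2 = int c] (mod int p)" by (auto simp: QuadRes_def)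
    define x where "x = nat (y mod int p)"
    have x: "int x = y mod int p" using assms by (simp add: x_def)
    have "int (x\<^sup>2 mod p) = y\<^sup>2 mod int p"
      by (simp add: x zmod_int power_mod)
    also have "\<dots> = int c" using y c by (simp add: cong_def zmod_int[symmetric])
    finally have "f x = c" by (simp add: f_def)
    moreover have "x < p" using assms x by (metis of_nat_less_iff pos_mod_bound of_nat_0_less_iff gr0I not_less0)
    moreover have "x \<noteq> 0" using \<open>f x = c\<close> c by (intro notI) (simp add: f_def)
    ultimately show "c \<in> f ` {0<..<p}" by auto
  qed
  moreover have "f ` {0<..<p} \<subseteq> {0<..<p}"
  proof
    fix y assume "y \<in> f ` {0<..<p}"
    then obtain x where x: "x \<in> {0<..<p}" "y = x\<^sup>2 mod p" by (auto simp: f_def)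
    have "\<not> p dvd x\<^sup>2" using ndvd[OF x(1)] assms(1) prime_dvd_power by blast
    hence "x\<^sup>2 mod p \<noteq> 0" by (simp add: mod_eq_0_iff_dvd)
    thus "y \<in> {0<..<p}" unfolding x(2) using assms by simp
  qed
  ultimately have "inj_on f {0<..<p}"
    by (intro eq_card_imp_inj_on) auto
  moreover have "f 1 = f (p - 1)"
  proof -
    have "(p - 1)\<^sup>2 = 1 + (p - 2) * p"
      using assms by (cases p; cases "p - 1") (auto simp: power2_eq_square algebra_simps)
    hence "f (p - 1) = (1 + (p - 2) * p) mod p" by (simp only: f_def)
    also have "\<dots> = 1 mod p" by (rule mod_mult_self1)
    finally show ?thesis by (simp add: f_def)
  qed
  ultimately have "1 = p - 1" using assms by (auto dest!: inj_onD)
  thus False using assms by simp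
qed

text \<open>Index 0 stands for the discriminant -4, index 2 for 8.\<close>
definition residue_char :: "nat \<Rightarrow> nat \<Rightarrow> int" where
  "residue_char i n = (if i = 0 then chi4 n else if i = 2 then chi8 n else Legendre n i)"

lemma chi4_mult: "chi4 (m * n) = chi4 m * chi4 n"
proof -
  have "(m * n) mod 4 = (m mod 4) * (n mod 4) mod 4" by (simp add: mod_mult_eq)
  moreover have "m mod 4 = 0 \<or> m mod 4 = 1 \<or> m mod 4 = 2 \<or> m mod 4 = 3"
    "n mod 4 = 0 \<or> n mod 4 = 1 \<or> n mod 4 = 2 \<or> n mod 4 = 3" by presburger+
  moreover have "even m \<longleftrightarrow> m mod 4 = 0 \<or> m mod 4 = 2" "even n \<longleftrightarrow> n mod 4 = 0 \<or> n mod 4 = 2"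
    by presburger+
  ultimately show ?thesis unfolding chi4_def by auto
qed

lemma chi8_mult: "chi8 (m * n) = chi8 m * chi8 n"
proof (cases "odd m \<and> odd n")
  case True
  have "(m * n) mod 8 = (m mod 8) * (n mod 8) mod 8" by (simp add: mod_mult_eq)
  moreover have "m mod 8 = 1 \<or> m mod 8 = 3 \<or> m mod 8 = 5 \<or> m mod 8 = 7"
    "n mod 8 = 1 \<or> n mod 8 = 3 \<or> n mod 8 = 5 \<or> n mod 8 = 7" using True by presburger+
  ultimately show ?thesis using True unfolding chi8_def by auto
qed (auto simp: chi8_def)

text \<open>The conductors are 4, 8 and the primes in P; the factor \<open>of_bool\<close> lifts all
  these characters to the common modulus M.\<close>

lemma real_character_residue_char:
  assumes M: "M = 8 * \<Prod>P" and P: "finite P" "\<And>p. p \<in> P \<Longrightarrow> prime p \<and> odd p"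
    and i: "i \<in> insert 0 (insert 2 P)"
  shows "real_character M (\<lambda>n. of_bool (coprime n M) * residue_char i n)"
  unfolding real_character_def
proof (intro conjI allI)
  have prime: "prime i \<and> 2 < i" if "i \<noteq> 0" "i \<noteq> 2"
    using that i P(2) prime_ge_2_nat[of i] by fastforce
  have "residue_char i (m * n) = residue_char i m * residue_char i n" for m n
    using prime by (auto simp: residue_char_def chi4_mult chi8_mult Legendre_mult)
  thus "of_bool (coprime (m * n) M) * residue_char i (m * n)
      = of_bool (coprime m M) * residue_char i m * (of_bool (coprime n M) * residue_char i n)" for m n
    by (auto simp: coprime_mult_left_iff)
  have "coprime (n + M) M \<longleftrightarrow> coprime n M" for n
    unfolding coprime_iff_gcd_eq_1 by simp
  moreover have "residue_char i (n + M) = residue_char i n" for n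
  proof -
    have "(n + M) mod 8 = n mod 8" "(n + M) mod 4 = n mod 4" "even (n + M) \<longleftrightarrow> even n"
      unfolding M by presburger+
    moreover have "Legendre (int (n + M)) (int i) = Legendre (int n) (int i)" if "i \<noteq> 0" "i \<noteq> 2"
    proof (rule Legendre_cong)
      have "i \<in> P" using i that by auto
      hence "int i dvd int M" unfolding M int_dvd_int_iff using dvd_prodI[OF P(1), of i "\<lambda>x. x"] by simp
      thus "[int (n + M) = int n] (mod int i)" by (simp add: cong_iff_dvd_diff)
    qed
    ultimately show ?thesis unfolding residue_char_def chi4_def chi8_def by simp
  qed
  ultimately show "of_bool (coprime (n + M) M) * residue_char i (n + M)
      = of_bool (coprime n M) * residue_char i n" for n by simp
  have "\<bar>residue_char i n\<bar> = 1" if "coprime n M" for n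
  proof -
    have "odd n" using coprime_divisors[of n n 2 M] that unfolding M by (simp add: coprime_right_2_iff_odd)
    moreover have "Legendre n i \<noteq> 0" if "i \<noteq> 0" "i \<noteq> 2"
    proof -
      have "i \<in> P" using i that by auto
      hence "i dvd M" unfolding M using dvd_prodI[OF P(1), of i "\<lambda>x. x"] by simp
      hence "coprime n i" using \<open>coprime n M\<close> coprime_divisors dvd_refl by blast
      hence "\<not> i dvd n" using prime that coprime_common_divisor[of n i i] by auto
      thus ?thesis by (simp add: Legendre_eq_0_iff)
    qed
    moreover have "\<bar>Legendre n i\<bar> = 1" if "Legendre n i \<noteq> 0"
      using that by (simp add: Legendre_def split: if_splits)
    ultimately show ?thesis
      unfolding residue_char_def chi4_def chi8_def by simp
  qed
  thus "of_bool (coprime n M) * residue_char i n = (if coprime n M then 1 else 0) \<or>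
      of_bool (coprime n M) * residue_char i n = (if coprime n M then - 1 else 0)" for n
    by (auto simp: abs_eq_iff')
qed

lemma residue_char_independent:
  assumes P: "finite P" "\<And>p. p \<in> P \<Longrightarrow> prime p \<and> odd p"
    and \<epsilon>: "\<And>i. i \<in> insert 0 (insert 2 P) \<Longrightarrow> \<epsilon> i = 1 \<or> \<epsilon> i = (-1 :: int)"
  shows "\<exists>c. coprime c (8 * \<Prod>P) \<and> (\<forall>i\<in>insert 0 (insert 2 P). residue_char i c = \<epsilon> i)"
proof -
  have big: "prime p \<and> 2 < p" if "p \<in> P" for p
    using P(2)[OF that] prime_ge_2_nat[of p] by (cases "p = 2") auto
  have "\<exists>u::nat. Legendre u p = \<epsilon> p" if "p \<in> P" for p
    using \<epsilon>[of p] that exists_Legendre_minus_1[of p] Legendre_1[of p] big[OF that]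
    by (metis insert_iff of_nat_1 of_nat_less_iff of_nat_numeral)
  then obtain v :: "nat \<Rightarrow> nat" where v: "\<And>p. p \<in> P \<Longrightarrow> Legendre (v p) p = \<epsilon> p" by metis
  \<comment> \<open>The classes 1, 5, 7, 3 modulo 8 realise the four sign pairs of
    \<open>chi4\<close> and \<open>chi8\<close>.\<close>
  define w :: nat where "w = (if \<epsilon> 0 = 1 then if \<epsilon> 2 = 1 then 1 else 5 else if \<epsilon> 2 = 1 then 7 else 3)"
  \<comment> \<open>Index 2 carries the modulus 8, which settles \<open>chi4\<close> and
    \<open>chi8\<close> together; index 0 gets no congruence of its own.\<close>
  define m where "m = (\<lambda>i::nat. if i = 2 then 8 else i)"
  have "2 \<notin> P" using big by blast
  have "\<exists>x. \<forall>i\<in>insert 2 P. [x = (if i = 2 then w else v i)] (mod m i)"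
  proof (rule chinese_remainder_nat)
    have "coprime (8::nat) p" if "p \<in> P" for p
      using P(2)[OF that] coprime_power_left_iff[of 2 3 p] by (simp add: coprime_left_2_iff_odd)
    thus "\<forall>i\<in>insert 2 P. \<forall>j\<in>insert 2 P. i \<noteq> j \<longrightarrow> coprime (m i) (m j)"
      using \<open>2 \<notin> P\<close> P(2) by (auto simp: m_def coprime_commute primes_coprime)
  qed (use P in auto)
  then obtain c where c: "\<And>i. i \<in> insert 2 P \<Longrightarrow> [c = (if i = 2 then w else v i)] (mod m i)"
    by blast
  have c8: "c mod 8 = w" using c[of 2] by (simp add: m_def cong_def w_def split: if_splits)
  have "odd c" using c8 unfolding w_def by presburger
  have leg: "Legendre c p = \<epsilon> p" if "p \<in> P" for p
  proof -
    have "p \<noteq> 2" using that \<open>2 \<notin> P\<close> by blast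
    hence "[c = v p] (mod p)" using c[of p] that by (simp add: m_def)
    hence "[int c = int (v p)] (mod int p)" by (simp add: cong_int_iff)
    thus ?thesis using Legendre_cong v[OF that] by metis
  qed
  have "residue_char i c = \<epsilon> i" if "i \<in> insert 0 (insert 2 P)" for i
  proof -
    have "chi4 c = \<epsilon> 0" "chi8 c = \<epsilon> 2"
      using c8 \<open>odd c\<close> \<epsilon>[of 0] \<epsilon>[of 2] unfolding chi4_def chi8_def w_def by (auto split: if_splits; presburger)+
    thus ?thesis using that leg by (auto simp: residue_char_def)
  qed
  moreover have "coprime c (8 * \<Prod>P)"
  proof -
    have "coprime c 8" using \<open>odd c\<close> coprime_power_right_iff[of c 2 3] by (simp add: coprime_right_2_iff_odd)
    moreover have "coprime c p" if "p \<in> P" for p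
    proof -
      have "\<not> p dvd c" using leg[OF that] \<epsilon>[of p] that Legendre_eq_0_iff[of c p] by auto
      thus ?thesis using P(2)[OF that] prime_imp_coprime coprime_commute by blast
    qed
    ultimately show ?thesis by (simp add: prod_coprime_right)
  qed
  ultimately show ?thesis by blast
qed

text \<open>Pass to the squarefree part of the n found before: a square coprime to M does not affect
  the characters, and the primes dividing the squarefree part are those of odd multiplicity in
  n.\<close>

lemma exists_squarefree_residue_chars:
  assumes P: "finite P" "\<And>p. p \<in> P \<Longrightarrow> prime p \<and> odd p"
    and J: "J \<subseteq> insert 0 (insert 2 P)" "J \<noteq> {}"
    and \<epsilon>: "\<And>i. i \<in> insert 0 (insert 2 P) \<Longrightarrow> \<epsilon> i = 1 \<or> \<epsilon> i = (-1 :: int)" "(\<Prod>i\<in>J. \<epsilon> i) = 1"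
  shows "\<exists>q>0. squarefree q \<and> coprime q (8 * \<Prod>P) \<and>
           (\<forall>i\<in>insert 0 (insert 2 P). residue_char i q = \<epsilon> i) \<and>
           (\<forall>l. prime l \<and> l dvd q \<longrightarrow> (\<Prod>i\<in>J. residue_char i l) = 1)"
proof -
  define M where "M = 8 * \<Prod>P"
  define \<psi> where "\<psi> = (\<lambda>i n. of_bool (coprime n M) * residue_char i n)"
  have \<psi>: "real_character M (\<psi> i)" if "i \<in> insert 0 (insert 2 P)" for i
    unfolding \<psi>_def by (rule real_character_residue_char[OF M_def P that])
  have "M > 0" using P prime_gt_0_nat by (auto simp: M_def intro!: prod_pos)
  have "\<exists>n>0. coprime n M \<and> (\<forall>i\<in>insert 0 (insert 2 P). \<psi> i n = \<epsilon> i) \<and>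
          (\<forall>p. prime p \<and> odd (multiplicity p n) \<longrightarrow> (\<Prod>i\<in>J. \<psi> i p) = 1)"
  proof (rule exists_prescribed_characters[OF \<open>M > 0\<close> _ \<psi> _ J \<epsilon>])
    fix \<eta> :: "nat \<Rightarrow> int" assume "\<And>i. i \<in> insert 0 (insert 2 P) \<Longrightarrow> \<eta> i = 1 \<or> \<eta> i = -1"
    hence "\<exists>c. coprime c (8 * \<Prod>P) \<and> (\<forall>i\<in>insert 0 (insert 2 P). residue_char i c = \<eta> i)"
      using residue_char_independent[OF P, where \<epsilon> = \<eta>] by blast
    thus "\<exists>c. \<forall>i\<in>insert 0 (insert 2 P). \<psi> i c = \<eta> i"
      unfolding \<psi>_def M_def by (metis mult_1 of_bool_eq(2))
  qed (use P in auto)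
  then obtain n where n: "n > 0" "coprime n M" "\<And>i. i \<in> insert 0 (insert 2 P) \<Longrightarrow> \<psi> i n = \<epsilon> i"
    "\<And>p. prime p \<Longrightarrow> odd (multiplicity p n) \<Longrightarrow> (\<Prod>i\<in>J. \<psi> i p) = 1" by blast
  define q s :: nat where "q = squarefree_part n" and "s = square_part n"
  have qs: "n = q * s\<^sup>2" unfolding q_def s_def by (rule squarefree_decompose)
  have cop: "coprime q M" "coprime s M"
    using n(2) unfolding qs by auto
  have "q > 0" using n(1) qs by (cases q) auto
  moreover have "squarefree q" by (simp add: q_def)
  moreover have "residue_char i q = \<epsilon> i" if "i \<in> insert 0 (insert 2 P)" for i
  proof -
    have "\<psi> i n = \<psi> i q * (\<psi> i s * \<psi> i s)"
      unfolding qs power2_eq_square real_character_mult[OF \<psi>[OF that]] ..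
    also have "\<dots> = \<psi> i q" using real_character_square[OF \<psi>[OF that] cop(2)] by simp
    finally show ?thesis using n(3)[OF that] cop(1) by (simp add: \<psi>_def)
  qed
  moreover have "(\<Prod>i\<in>J. residue_char i l) = 1" if l: "prime l" "l dvd q" for l
  proof -
    have "multiplicity l q > 0" using l \<open>q > 0\<close> by (simp add: prime_multiplicity_gt_zero_iff)
    hence "odd (multiplicity l n)"
      unfolding q_def prime_multiplicity_squarefree_part[OF l(1)] by presburger
    hence "(\<Prod>i\<in>J. \<psi> i l) = 1" using n(4) l(1) by blast
    moreover have "coprime l M" using cop(1) l(2) coprime_divisors dvd_refl by blast
    ultimately show ?thesis by (simp add: \<psi>_def)
  qed
  ultimately show ?thesis using cop(1) unfolding M_def by blast
qed

subsection \<open>The auxiliary integer $q$\<close>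

lemma prod_prime_factors_squarefree:
  fixes n :: nat
  assumes "squarefree n"
  shows "\<Prod>(prime_factors n) = n"
proof -
  have "n \<noteq> 0" using assms by (intro notI) simp
  have "multiplicity p n = 1" if "p \<in> prime_factors n" for p
    using assms that \<open>n \<noteq> 0\<close> squarefree_factorial_semiring'[of n] by auto
  hence "\<Prod>(prime_factors n) = (\<Prod>p\<in>prime_factors n. p ^ multiplicity p n)"
    by (intro prod.cong) auto
  thus ?thesis using prime_factorization_nat[of n] \<open>n \<noteq> 0\<close> by simp
qed

text \<open>Chinese remaindering, one prime at a time. This is what allows a squarefree q in place
  of a prime.\<close>

lemma square_root_mod_squarefree:
  fixes n :: nat and a :: int
  assumes "squarefree n" "\<And>p. prime p \<Longrightarrow> p dvd n \<Longrightarrow> QuadRes p a"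
  shows "\<exists>x. [x\<^sup>2 = a] (mod n)"
  using assms
proof (induction n rule: less_induct)
  case (less n)
  show ?case
  proof (cases "n = 1")
    case False
    then obtain p where p: "prime p" "p dvd n" using prime_factor_nat by blast
    then obtain k where k: "n = p * k" by (elim dvdE)
    have "n \<noteq> 0" using less.prems(1) by (intro notI) simp
    hence "k > 0" using k by (cases k) auto
    hence "k < n" using k prime_gt_1_nat[OF p(1)] by simp
    have sk: "squarefree k" using less.prems(1) squarefree_multD(2) unfolding k by blast
    have "\<not> p dvd k"
    proof
      assume "p dvd k"
      hence "p\<^sup>2 dvd n" unfolding k power2_eq_square by simp
      thus False using squarefreeD[OF less.prems(1)] p(1) not_prime_unit by blast
    qed
    hence cop: "coprime (int p) (int k)" using p(1) prime_imp_coprime by auto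
    obtain y where y: "[y\<^sup>2 = a] (mod k)"
      using less.IH[OF \<open>k < n\<close> sk] less.prems(2) k by auto
    obtain z where z: "[z\<^sup>2 = a] (mod p)"
      using less.prems(2)[OF p] by (auto simp: QuadRes_def)
    obtain x where x: "[x = z] (mod p)" "[x = y] (mod k)"
      using binary_chinese_remainder_int[OF cop] by blast
    have "[x\<^sup>2 = a] (mod p)" "[x\<^sup>2 = a] (mod k)"
      using cong_pow[OF x(1), of 2] cong_pow[OF x(2), of 2] y z cong_trans by blast+
    hence "[x\<^sup>2 = a] (mod (int p * int k))"
      using cop coprime_cong_mult by blast
    thus ?thesis unfolding k by auto
  qed auto
qed

lemma Legendre_prod:
  assumes "prime l" "2 < l"
  shows "Legendre (\<Prod>i\<in>A. f i) (int l) = (\<Prod>i\<in>A. Legendre (f i) l)"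
proof (induction A rule: infinite_finite_induct)
  case (insert x A)
  thus ?case using Legendre_mult[OF assms] by simp
qed (use assms Legendre_1[of "int l"] in auto)

lemma chi4_prod: "finite A \<Longrightarrow> chi4 (\<Prod>i\<in>A. f i) = (\<Prod>i\<in>A. chi4 (f i))"
  by (induction A rule: finite_induct) (simp_all add: chi4_mult, simp add: chi4_def)

lemma chi8_prod: "finite A \<Longrightarrow> chi8 (\<Prod>i\<in>A. f i) = (\<Prod>i\<in>A. chi8 (f i))"
  by (induction A rule: finite_induct) (simp_all add: chi8_mult, simp add: chi8_def)

text \<open>The product of U modulo 4 records the parity of the number of its elements that are 3
  mod 4.\<close>

lemma prod_reciprocity_sign:
  assumes "finite U" "\<And>p. p \<in> U \<Longrightarrow> odd p" "x * x = (1 :: int)"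
  shows "(\<Prod>p\<in>U. if p mod 4 = 3 then x else 1) = (if \<Prod>U mod 4 = (1::nat) then 1 else x)"
proof -
  have "(\<Prod>p\<in>U. if p mod 4 = 3 then x else 1) = (if \<Prod>U mod 4 = (1::nat) then 1 else x) \<and> odd (\<Prod>U)"
    using assms(1,2)
  proof (induction U rule: finite_induct)
    case (insert p U)
    have "odd p" "odd (\<Prod>U)" using insert by auto
    hence "p mod 4 = 1 \<or> p mod 4 = 3" "\<Prod>U mod 4 = 1 \<or> \<Prod>U mod 4 = 3"
      by presburger+
    moreover have "(p * \<Prod>U) mod 4 = (p mod 4) * (\<Prod>U mod 4) mod 4" by (simp add: mod_mult_eq)
    ultimately show ?case using insert assms(3) by auto
  qed simp
  thus ?thesis by blast
qed

text \<open>The factor \<open>chi4 l\<close> coming from -1 cancels the sign of reciprocity when the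
  product of U is 3 mod 4. So index 0 remains exactly if minus this product is not 1 mod 4, in
  accordance with the discriminant.\<close>

lemma Legendre_as_residue_chars:
  assumes U: "finite U" "\<And>p. p \<in> U \<Longrightarrow> prime p \<and> odd p" and l: "prime l" "2 < l" "l \<notin> U"
  shows "Legendre (- ((if e then 2 else 1) * int (\<Prod>U))) l
     = (\<Prod>i\<in>U \<union> (if \<Prod>U mod 4 = 1 then {0} else {}) \<union> (if e then {2} else {}). residue_char i l)"
proof -
  have U': "p > 2" if "p \<in> U" for p using U(2)[OF that] prime_ge_2_nat[of p] by (cases "p = 2") auto
  have notin: "0 \<notin> U" "2 \<notin> U" using U' by blast+
  have "odd l" using l prime_odd_nat by auto
  hence chi4_sq: "chi4 l * chi4 l = 1" by (auto simp: chi4_def)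
  have "(\<Prod>p\<in>U. Legendre (int p) l) = (\<Prod>p\<in>U. Legendre l p * (if p mod 4 = 3 then chi4 l else 1))"
    by (intro prod.cong Legendre_reciprocity) (use U U' l in auto)
  also have "\<dots> = (\<Prod>p\<in>U. residue_char p l) * (\<Prod>p\<in>U. if p mod 4 = 3 then chi4 l else 1)"
    unfolding prod.distrib using notin
    by (intro arg_cong2[of _ _ _ _ times] prod.cong) (auto simp: residue_char_def)
  also have "(\<Prod>p\<in>U. if p mod 4 = 3 then chi4 l else 1) = (if \<Prod>U mod 4 = 1 then 1 else chi4 l)"
    by (rule prod_reciprocity_sign) (use U chi4_sq in auto)
  finally have 1: "(\<Prod>p\<in>U. Legendre (int p) l)
      = (\<Prod>p\<in>U. residue_char p l) * (if \<Prod>U mod 4 = 1 then 1 else chi4 l)" .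
  have "- ((if e then 2 else 1) * int (\<Prod>U)) = (-1) * ((if e then 2 else 1) * (\<Prod>p\<in>U. int p))"
    by simp
  also have "Legendre \<dots> l = Legendre (-1) l * (Legendre (if e then 2 else 1) l * (\<Prod>p\<in>U. Legendre (int p) l))"
    by (simp only: Legendre_mult[OF l(1,2)] Legendre_prod[OF l(1,2)])
  also have "Legendre (-1) l = chi4 l" by (rule Legendre_minus_1[OF l(1,2)])
  also have "Legendre (if e then 2 else 1) l = (if e then chi8 l else 1)"
    using Legendre_2[OF l(1,2)] Legendre_1[of "int l"] l(2) by simp
  finally have "Legendre (- ((if e then 2 else 1) * int (\<Prod>U))) l
      = (\<Prod>p\<in>U. residue_char p l) * (if \<Prod>U mod 4 = 1 then chi4 l else 1) * (if e then chi8 l else 1)"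
    unfolding 1 using chi4_sq by (cases e; cases "\<Prod>U mod 4 = 1") (simp_all add: ac_simps)
  also have "\<dots> = (\<Prod>i\<in>U \<union> (if \<Prod>U mod 4 = 1 then {0} else {}) \<union> (if e then {2} else {}). residue_char i l)"
    using notin U(1) by (cases e; cases "\<Prod>U mod 4 = 1") (simp_all add: residue_char_def ac_simps)
  finally show ?thesis .
qed

lemma Legendre_minus:
  assumes "prime p" "2 < p"
  shows "Legendre (- a) (int p) = chi4 p * Legendre a p"
  using Legendre_mult[OF assms, of "-1" a] Legendre_minus_1[OF assms] by simp

text \<open>Descent: dividing X and Y by a common factor p lowers the valuation by 2. The second
  alternative in \<open>hyp\<close> serves p = 2, where odd X and Y are possible but the valuation
  is known directly.\<close>

lemma multiplicity_norm_even:
  fixes p D :: int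
  assumes p: "prime p"
    and hyp: "\<And>X Y. p dvd X\<^sup>2 + D * Y\<^sup>2 \<Longrightarrow> (p dvd X \<and> p dvd Y) \<or> even (multiplicity p (X\<^sup>2 + D * Y\<^sup>2))"
    and "X\<^sup>2 + D * Y\<^sup>2 \<noteq> 0"
  shows "even (multiplicity p (X\<^sup>2 + D * Y\<^sup>2))"
  using assms(3)
proof (induction "nat (\<bar>X\<bar> + \<bar>Y\<bar>)" arbitrary: X Y rule: less_induct)
  case less
  show ?case
  proof (cases "p dvd X \<and> p dvd Y")
    case True
    then obtain x y where xy: "X = p * x" "Y = p * y" by (auto elim!: dvdE)
    have p2: "p > 1" using p prime_gt_1_int by blast
    have eq: "X\<^sup>2 + D * Y\<^sup>2 = p\<^sup>2 * (x\<^sup>2 + D * y\<^sup>2)"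
      by (simp add: xy power2_eq_square algebra_simps)
    hence nz: "x\<^sup>2 + D * y\<^sup>2 \<noteq> 0" using less.prems by auto
    have le: "\<bar>z\<bar> \<le> \<bar>p * z\<bar>" "z \<noteq> 0 \<Longrightarrow> \<bar>z\<bar> < \<bar>p * z\<bar>" for z
      using p2 mult_right_mono[of 1 p "\<bar>z\<bar>"] by (auto simp: abs_mult)
    have "x \<noteq> 0 \<or> y \<noteq> 0" using nz by auto
    hence "\<bar>x\<bar> + \<bar>y\<bar> < \<bar>X\<bar> + \<bar>Y\<bar>"
      unfolding xy using le[of x] le[of y] by linarith
    hence "even (multiplicity p (x\<^sup>2 + D * y\<^sup>2))" using less.hyps nz by simp
    moreover have "multiplicity p (X\<^sup>2 + D * Y\<^sup>2) = 2 + multiplicity p (x\<^sup>2 + D * y\<^sup>2)"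
      unfolding eq using p nz p2
      by (subst prime_elem_multiplicity_mult_distrib) auto
    ultimately show ?thesis by simp
  next
    case False
    thus ?thesis using hyp[of X Y] not_dvd_imp_multiplicity_0[of p] by fastforce
  qed
qed

lemma QuadRes_if_dvd_norm:
  fixes p D :: int
  assumes p: "prime p" and "p dvd X\<^sup>2 + D * Y\<^sup>2" "\<not> p dvd Y"
  shows "QuadRes p (- D)"
proof -
  have "coprime Y p" using assms(3) p prime_imp_coprime coprime_commute by blast
  then obtain z where z: "[Y * z = 1] (mod p)" using cong_solve_coprime_int by blast
  have "[(X * z)\<^sup>2 - (- D) = (X\<^sup>2 + D * Y\<^sup>2) * z\<^sup>2 - D * ((Y * z)\<^sup>2 - 1)] (mod p)"
    by (simp add: power2_eq_square algebra_simps)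
  moreover have "p dvd (Y * z)\<^sup>2 - 1"
    using cong_pow[OF z, of 2] by (simp add: cong_iff_dvd_diff)
  hence "p dvd (X\<^sup>2 + D * Y\<^sup>2) * z\<^sup>2 - D * ((Y * z)\<^sup>2 - 1)"
    using assms(2) by (intro dvd_diff[OF dvd_mult2 dvd_mult])
  ultimately have "p dvd (X * z)\<^sup>2 - (- D)" using cong_dvd_iff by blast
  thus ?thesis unfolding QuadRes_def cong_iff_dvd_diff by blast
qed

lemma QuadRes_imp_Legendre:
  "QuadRes p a \<Longrightarrow> \<not> p dvd a \<Longrightarrow> Legendre a p = 1"
  by (simp add: Legendre_def cong_0_iff)

lemma mult_mod_eqI:
  fixes a b n r :: nat
  assumes "b mod n = r"
  shows "(a * b) mod n = (a * r) mod n"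
  unfolding assms[symmetric] by (rule mod_mult_right_eq[symmetric])

lemma mod_4_eq_1_imp:
  fixes n :: nat
  assumes "n mod 4 = 1"
  shows "n mod 8 = 1 \<or> n mod 8 = 5"
proof -
  define k where "k = n div 4"
  have n: "n = 4 * k + 1" using div_mult_mod_eq[of n 4] assms by (simp add: k_def)
  show ?thesis
  proof (cases "even k")
    case True
    then obtain j where "k = 2 * j" by (rule evenE)
    thus ?thesis using n by simp
  next
    case False
    then obtain j where "k = 2 * j + 1" by (rule oddE)
    hence "n = 5 + 8 * j" using n by simp
    thus ?thesis by simp
  qed
qed

text \<open>
  The character values $(q/p)=(-1/p)$ at the odd primes $p$ dividing $3m$ are compatible, via
  reciprocity, with $(-3m/l)=1$ for the primes $l$ dividing $q$, if $q$ is odd and in the stated class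
  modulo 8. For $m$ congruent to 1 modulo 8 this needs an even $q=2q_0$, hence $(q_0/p)=(-2/p)$.
  The number $u$ is the squarefree part of the odd part of $3m$.
\<close>
lemma exists_auxiliary_q:
  fixes m :: nat
  assumes "squarefree m" "m mod 8 = 1 \<or> m mod 8 = 2 \<or> m mod 8 = 3 \<or> m mod 8 = 6 \<or> m mod 8 = 7"
  shows "\<exists>q>0. coprime q m \<and> (\<exists>b h. b\<^sup>2 + 3 * int m = int q * h) \<and> (\<exists>t. int m dvd t\<^sup>2 * int q + 1)
     \<and> (\<forall>p. prime p \<and> odd p \<and> p dvd q \<longrightarrow> \<not> p dvd 3 * m \<and> QuadRes p (- (3 * int m)))
     \<and> (\<forall>p. prime p \<and> odd p \<and> p dvd m \<longrightarrow> Legendre (- int q) p = 1)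
     \<and> (m mod 4 = 3 \<and> q mod 4 = 1 \<or> m mod 8 = 1 \<and> q mod 4 = 2 \<or> m mod 8 = 2 \<and> q mod 8 = 5
          \<or> m mod 8 = 6 \<and> q mod 8 = 1)"
proof -
  define e where "e = even m"
  define c where "c \<longleftrightarrow> m mod 8 = 1"
  define m' where "m' = (if e then m div 2 else m)"
  define u where "u = (if 3 dvd m' then m' div 3 else 3 * m')"
  define k :: int where "k = (if 3 dvd m' then 3 else 1)"
  define P where "P = prime_factors (3 * m')"
  define U where "U = prime_factors u"
  \<comment> \<open>The product of the characters in \<open>J\<close> is (-3m/l), because 3m is a
    square times \<open>u\<close>, with a further factor 2 if m is even.\<close>
  define J where "J = U \<union> (if \<Prod>U mod 4 = 1 then {0} else {}) \<union> (if e then {2} else {})"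
  have m: "m = (if e then 2 else 1) * m'" by (simp add: m'_def e_def)
  have "m \<noteq> 0" using assms(2) by (intro notI) simp
  have "odd m'"
  proof (cases e)
    case True
    hence "m = 2 * m'" using m by simp
    thus ?thesis using assms(2) by presburger
  qed (simp add: m'_def e_def)
  have sq': "squarefree m'" using assms(1) squarefree_mono[of m' m] m by auto
  have "m' > 0" using \<open>odd m'\<close> by (cases m') auto
  have uk: "int u * k\<^sup>2 = 3 * int m'"
    by (auto simp: u_def k_def power2_eq_square zdiv_int)
  have "squarefree u"
  proof (cases "3 dvd m'")
    case True
    hence "u dvd m'" by (auto simp: u_def elim!: dvdE)
    thus ?thesis using squarefree_mono sq' by blast
  next
    case False
    have "prime (3::nat)" by simp
    hence "coprime 3 m'" using False prime_imp_coprime by blast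
    thus ?thesis using False sq' squarefree_prime[OF \<open>prime (3::nat)\<close>] squarefree_mult_coprime
      by (simp add: u_def)
  qed
  have "u dvd 3 * m'" by (auto simp: u_def)
  have "odd u" using \<open>u dvd 3 * m'\<close> \<open>odd m'\<close> by (metis dvd_trans even_mult_iff odd_numeral)
  have prodU: "\<Prod>U = u" unfolding U_def by (rule prod_prime_factors_squarefree[OF \<open>squarefree u\<close>])
  have u8: "u mod 8 = (3 * m') mod 8"
  proof (cases "3 dvd m'")
    case True
    hence "m' = 3 * u" by (simp add: u_def)
    thus ?thesis by presburger
  qed (simp add: u_def)
  have u4: "u mod 4 = (3 * m') mod 4"
  proof -
    have "u mod 4 = u mod 8 mod 4" "(3 * m') mod 4 = (3 * m') mod 8 mod 4"
      by (simp_all add: mod_mod_cancel)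
    thus ?thesis by (simp only: u8)
  qed
  have P: "finite P" "\<And>p. p \<in> P \<Longrightarrow> prime p \<and> odd p"
  proof -
    fix p assume "p \<in> P"
    hence "prime p" "p dvd 3 * m'" by (auto simp: P_def)
    moreover have "odd (3 * m')" using \<open>odd m'\<close> by simp
    ultimately show "prime p \<and> odd p" using dvd_trans by blast
  qed (simp add: P_def)
  have "U \<subseteq> P" unfolding U_def P_def using \<open>u dvd 3 * m'\<close> \<open>m' > 0\<close> by (intro dvd_prime_factors) auto
  have U: "finite U" "\<And>p. p \<in> U \<Longrightarrow> prime p \<and> odd p" "0 \<notin> U" "2 \<notin> U"
  proof -
    show "finite U" by (simp add: U_def)
    have *: "prime p \<and> odd p" if "p \<in> U" for p using P(2) that \<open>U \<subseteq> P\<close> by blast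
    show "\<And>p. p \<in> U \<Longrightarrow> prime p \<and> odd p" by (rule *)
    show "0 \<notin> U" "2 \<notin> U" using *[of 0] *[of 2] by auto
  qed
  \<comment> \<open>The value 1 at index 0 makes \<open>q0\<close> 1 mod 4. At odd i the value is
    (-1/i), or (-2/i) under \<open>c\<close>. The value at index 2 determines \<open>q0\<close> mod
    8 and is chosen so that for even m the product over \<open>J\<close> is 1.\<close>
  define \<epsilon> where "\<epsilon> = (\<lambda>i::nat. if i = 0 then 1 else if i = 2 then (if e then chi4 u else 1)
      else if c then chi4 i * chi8 i else chi4 i)"
  have chi4_sign: "chi4 n = 1 \<or> chi4 n = -1" if "odd n" for n using that by (auto simp: chi4_def)
  have chi8_sign: "chi8 n = 1 \<or> chi8 n = -1" if "odd n" for n using that by (auto simp: chi8_def)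
  have \<epsilon>: "\<epsilon> i = 1 \<or> \<epsilon> i = -1" if "i \<in> insert 0 (insert 2 P)" for i
    using that P(2)[of i] chi4_sign[of i] chi8_sign[of i] chi4_sign[OF \<open>odd u\<close>] by (auto simp: \<epsilon>_def)
  have prod_\<epsilon>: "(\<Prod>i\<in>J. \<epsilon> i) = 1"
  proof -
    have "(\<Prod>i\<in>J. \<epsilon> i) = (\<Prod>i\<in>U. \<epsilon> i) * (if e then chi4 u else 1)"
      using U(1,3,4) unfolding J_def by (auto simp: \<epsilon>_def)
    also have "(\<Prod>i\<in>U. \<epsilon> i) = (\<Prod>i\<in>U. if c then chi4 i * chi8 i else chi4 i)"
      using U(3,4) by (intro prod.cong) (auto simp: \<epsilon>_def)
    also have "\<dots> = (if c then chi4 u * chi8 u else chi4 u)"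
      using chi4_prod[OF U(1), of "\<lambda>x. x"] chi8_prod[OF U(1), of "\<lambda>x. x"] prodU
      by (simp add: prod.distrib)
    also have "\<dots> * (if e then chi4 u else 1) = 1"
    \<comment> \<open>For even m the two factors \<open>chi4 u\<close> cancel. For m = 1 mod 8, u is
      3 mod 8, where \<open>chi4\<close> and \<open>chi8\<close> are both -1. In the remaining case
      m is 3 mod 4 and u is 1 mod 4.\<close>
    proof (cases e)
      case True
      hence "\<not> c" unfolding c_def e_def by presburger
      thus ?thesis using True chi4_sign[OF \<open>odd u\<close>] by auto
    next
      case False
      hence m': "m' = m" "odd m" by (simp_all add: m'_def e_def)
      show ?thesis
      proof (cases c)
        case True
        hence "m mod 8 = 1" unfolding c_def .
        from mult_mod_eqI[OF this, of 3] have "(3 * m) mod 8 = 3" by simp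
        hence "u mod 8 = 3" by (simp only: u8 m'(1))
        moreover have "u mod 4 = u mod 8 mod 4" by (simp add: mod_mod_cancel)
        ultimately have "u mod 8 = 3" "u mod 4 = 3" by simp_all
        thus ?thesis using \<open>odd u\<close> True False by (simp add: chi4_def chi8_def)
      next
        case c: False
        have "m mod 8 \<noteq> 2" "m mod 8 \<noteq> 6" using m'(2) by presburger+
        hence "m mod 8 = 3 \<or> m mod 8 = 7" using c assms(2) unfolding c_def by blast
        moreover have "m mod 4 = m mod 8 mod 4" by (simp add: mod_mod_cancel)
        ultimately have "m mod 4 = 3" by auto
        from mult_mod_eqI[OF this, of 3] have "(3 * m) mod 4 = 1" by simp
        hence "u mod 4 = 1" by (simp only: u4 m'(1))
        hence "chi4 u = 1" using \<open>odd u\<close> unfolding chi4_def by (simp only: if_False if_True refl)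
        thus ?thesis using c False by simp
      qed
    qed
    finally show ?thesis .
  qed
  \<comment> \<open>If \<open>U\<close> is empty, its product is 1, and then index 0 belongs to
    \<open>J\<close>.\<close>
  have "J \<noteq> {}"
  proof
    assume "J = {}"
    hence "U = {}" "\<Prod>U mod 4 \<noteq> 1" by (auto simp: J_def split: if_splits)
    thus False by simp
  qed
  have "J \<subseteq> insert 0 (insert 2 P)" using \<open>U \<subseteq> P\<close> by (auto simp: J_def)
  from exists_squarefree_residue_chars[OF P this \<open>J \<noteq> {}\<close> \<epsilon> prod_\<epsilon>] obtain q0 where
    q0: "q0 > 0" "squarefree q0" "coprime q0 (8 * \<Prod>P)"
      "\<And>i. i \<in> insert 0 (insert 2 P) \<Longrightarrow> residue_char i q0 = \<epsilon> i"
      "\<And>l. prime l \<Longrightarrow> l dvd q0 \<Longrightarrow> (\<Prod>i\<in>J. residue_char i l) = 1" by blast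
  have "odd q0" using coprime_divisors[of q0 q0 2 "8 * \<Prod>P"] q0(3) by (simp add: coprime_right_2_iff_odd)
  have P_ndvd: "\<not> p dvd q0" if "p \<in> P" for p
  proof
    assume "p dvd q0"
    moreover have "p dvd 8 * \<Prod>P" using dvd_prodI[OF P(1) that, of "\<lambda>x. x"] by simp
    ultimately show False using q0(3) coprime_common_divisor P(2)[OF that] not_prime_unit by blast
  qed
  have ndvd: "\<not> p dvd 3 * m" if "prime p" "p dvd q0" for p
  proof
    assume "p dvd 3 * m"
    moreover have "odd p" using that(2) \<open>odd q0\<close> dvd_trans by blast
    hence "\<not> p dvd 2" using primes_dvd_imp_eq[OF that(1) two_is_prime_nat] by auto
    ultimately have "p dvd 3 * m'" using that(1) unfolding m
      by (auto simp: prime_dvd_mult_iff split: if_splits)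
    hence "p \<in> P" using that(1) \<open>m' > 0\<close> by (auto simp: P_def prime_factors_dvd)
    thus False using P_ndvd that(2) by blast
  qed
  have QR: "QuadRes l (- (3 * int m))" if l: "prime l" "l dvd q0" for l
  proof -
    have "odd l" using l(2) \<open>odd q0\<close> dvd_trans by blast
    hence "l > 2" using l(1) prime_ge_2_nat[of l] by (cases "l = 2") auto
    have "l \<notin> U" using l(2) P_ndvd \<open>U \<subseteq> P\<close> by blast
    have "Legendre (- ((if e then 2 else 1) * int u)) l = 1"
      using Legendre_as_residue_chars[OF U(1,2) l(1) \<open>l > 2\<close> \<open>l \<notin> U\<close>, of e] q0(5)[OF l]
      unfolding prodU J_def by simp
    then obtain y where "[y\<^sup>2 = - ((if e then 2 else 1) * int u)] (mod l)"
      using Legendre_eq_1_imp_QuadRes unfolding QuadRes_def by blast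
    hence "[y\<^sup>2 * k\<^sup>2 = - ((if e then 2 else 1) * int u) * k\<^sup>2] (mod l)"
      by (rule cong_scalar_right)
    moreover have "- ((if e then 2 else 1) * int u) * k\<^sup>2 = - ((if e then 2 else 1) * (int u * k\<^sup>2))"
      by simp
    moreover have "\<dots> = - (3 * int m)" unfolding uk using m by auto
    ultimately show ?thesis unfolding QuadRes_def by (metis power_mult_distrib)
  qed
  define q where "q = (if c then 2 else 1) * q0"
  have "q > 0" using q0(1) by (simp add: q_def)
  have "c \<Longrightarrow> odd m" unfolding c_def by presburger
  have odd_dvd: "p dvd q0" if "prime p" "odd p" "p dvd q" for p
    using that primes_dvd_imp_eq[OF that(1) two_is_prime_nat]
    unfolding q_def by (auto simp: prime_dvd_mult_iff split: if_splits)
  have "coprime q m"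
  proof (rule ccontr)
    assume "\<not> coprime q m"
    hence "gcd q m \<noteq> 1" using coprime_iff_gcd_eq_1 by blast
    then obtain p where "prime p" "p dvd gcd q m" using prime_factor_nat by blast
    hence p: "prime p" "p dvd q" "p dvd m" by auto
    show False
    proof (cases "odd p")
      case True
      thus False using odd_dvd[OF p(1) True p(2)] ndvd[OF p(1)] p(3) by simp
    next
      case False
      hence "even q" "even m" using p dvd_trans by blast+
      thus False using \<open>odd q0\<close> \<open>c \<Longrightarrow> odd m\<close> by (auto simp: q_def split: if_splits)
    qed
  qed
  have Leg: "Legendre (- int q) p = 1" if p: "prime p" "odd p" "p dvd m" for p
  proof -
    have p2: "p > 2" using p prime_ge_2_nat[of p] by (cases "p = 2") auto
    have "\<not> p dvd 2" using p2 dvd_imp_le[of p 2] by auto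
    hence "p dvd 3 * m'" using p(1,3) unfolding m by (auto simp: prime_dvd_mult_iff split: if_splits)
    hence "p \<in> P" using p(1) \<open>m' > 0\<close> by (auto simp: P_def prime_factors_dvd)
    hence "residue_char p q0 = \<epsilon> p" using q0(4) by blast
    hence L: "Legendre (int q0) p = (if c then chi4 p * chi8 p else chi4 p)"
      using p2 by (simp add: residue_char_def \<epsilon>_def)
    have "Legendre (- int q) p = chi4 p * (if c then chi8 p * Legendre q0 p else Legendre q0 p)"
      using Legendre_minus[OF p(1) p2, of "int q"] Legendre_mult[OF p(1) p2, of 2 "int q0"]
        Legendre_2[OF p(1) p2] by (simp add: q_def)
    thus ?thesis unfolding L using chi4_sign[OF p(2)] chi8_sign[OF p(2)] by auto
  qed
  have "\<exists>b h. b\<^sup>2 + 3 * int m = int q * h"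
  proof -
    obtain b where "[b\<^sup>2 = - (3 * int m)] (mod q0)"
      using square_root_mod_squarefree[OF q0(2), of "- (3 * int m)"] QR by blast
    hence b: "int q0 dvd b\<^sup>2 + 3 * int m" by (simp add: cong_iff_dvd_diff)
    \<comment> \<open>An odd root makes b'^2 + 3m even for odd m, as q = 2 q0 demands under
      \<open>c\<close>.\<close>
    define b' where "b' = (if odd b then b else b + int q0)"
    have "odd b'" using \<open>odd q0\<close> by (simp add: b'_def)
    have "int q0 dvd b'\<^sup>2 + 3 * int m"
    proof (cases "odd b")
      case False
      have "(b + int q0)\<^sup>2 + 3 * int m = (b\<^sup>2 + 3 * int m) + int q0 * (2 * b + int q0)"
        by (simp add: power2_eq_square algebra_simps)
      hence "int q0 dvd (b + int q0)\<^sup>2 + 3 * int m" using b by (metis dvd_add dvd_triv_left)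
      thus ?thesis using False by (simp add: b'_def)
    qed (use b in \<open>simp add: b'_def\<close>)
    moreover have "2 dvd b'\<^sup>2 + 3 * int m" if c using \<open>odd b'\<close> \<open>c \<Longrightarrow> odd m\<close>[OF that] by simp
    moreover have "coprime 2 (int q0)" using \<open>odd q0\<close> by (simp add: coprime_left_2_iff_odd)
    ultimately have "int q dvd b'\<^sup>2 + 3 * int m"
      unfolding q_def by (auto intro: divides_mult)
    thus ?thesis by (auto elim!: dvdE)
  qed
  moreover have "\<exists>t. int m dvd t\<^sup>2 * int q + 1"
  proof -
    have "QuadRes p (- int q)" if p: "prime p" "p dvd m" for p :: nat
    proof (cases "odd p")
      case True
      thus ?thesis using Leg p Legendre_eq_1_imp_QuadRes by blast
    next
      case False
      hence "p = 2" using p(1) prime_odd_nat prime_ge_2_nat[OF p(1)] by fastforce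
      moreover have "[(- int q)\<^sup>2 = - int q] (mod 2)" by (simp add: cong_iff_dvd_diff)
      ultimately show ?thesis unfolding QuadRes_def by auto
    qed
    from square_root_mod_squarefree[OF assms(1) this] obtain x where
      x: "[x\<^sup>2 = - int q] (mod m)" by blast
    have "coprime (- int q) (int m)" using \<open>coprime q m\<close> by simp
    hence "coprime (x\<^sup>2) (int m)" using x cong_imp_coprime cong_sym by blast
    hence "coprime x (int m)" by simp
    \<comment> \<open>The witness t is the inverse of a root x of -q: multiplying x^2 + q = 0 by y^2
      gives 1 + y^2 q = 0 modulo m.\<close>
    then obtain y where y: "[x * y = 1] (mod m)" using cong_solve_coprime_int by blast
    have "y\<^sup>2 * int q + 1 = y\<^sup>2 * (x\<^sup>2 - (- int q)) - ((x * y)\<^sup>2 - 1)"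
      by (simp add: power2_eq_square algebra_simps)
    moreover have "int m dvd x\<^sup>2 - (- int q)" using x unfolding cong_iff_dvd_diff .
    moreover have "int m dvd (x * y)\<^sup>2 - 1"
      using cong_pow[OF y, of 2] by (simp add: cong_iff_dvd_diff)
    ultimately have "int m dvd y\<^sup>2 * int q + 1" by (metis dvd_diff dvd_mult)
    thus ?thesis by blast
  qed
  moreover have "m mod 4 = 3 \<and> q mod 4 = 1 \<or> m mod 8 = 1 \<and> q mod 4 = 2 \<or> m mod 8 = 2 \<and> q mod 8 = 5
          \<or> m mod 8 = 6 \<and> q mod 8 = 1"
  proof -
    have "chi4 q0 = 1" using q0(4)[of 0] by (simp add: residue_char_def \<epsilon>_def)
    hence q4: "q0 mod 4 = 1" by (simp add: chi4_def split: if_splits)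
    have q8: "chi8 q0 = (if e then chi4 u else 1)"
      using q0(4)[of 2] by (simp add: residue_char_def \<epsilon>_def)
    consider "m mod 4 = 3" | c | "m mod 8 = 2" | "m mod 8 = 6"
    proof -
      have "m mod 4 = 3" if "m mod 8 = 3 \<or> m mod 8 = 7" using that by presburger
      thus thesis using assms(2) that unfolding c_def by blast
    qed
    thus ?thesis
    proof cases
      case 1
      hence "\<not> c" unfolding c_def by presburger
      thus ?thesis using 1 q4 by (simp add: q_def)
    next
      case 2
      hence "q = 2 * q0" by (simp add: q_def)
      hence "q mod 4 = 2" using q4 by presburger
      thus ?thesis using 2 c_def by blast
    next
      case 3
      have "even m" using 3 by presburger
      hence *: "\<not> c" e "m = 2 * m'" using m 3 unfolding c_def e_def by auto
      have "m' mod 4 = 1" using 3 *(3) mod_mult_mult1[of 2 m' 4] by simp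
      from mult_mod_eqI[OF this, of 3] have "u mod 4 = 3" unfolding u4 by simp
      hence "chi8 q0 = -1" using q8 * \<open>odd u\<close> by (simp add: chi4_def)
      hence "q0 mod 8 \<noteq> 1" using \<open>odd q0\<close> by (auto simp: chi8_def)
      hence "q0 mod 8 = 5" using mod_4_eq_1_imp[OF q4] by blast
      thus ?thesis using 3 * by (simp add: q_def)
    next
      case 4
      have "even m" using 4 by presburger
      hence *: "\<not> c" e "m = 2 * m'" using m 4 unfolding c_def e_def by auto
      have "m' mod 4 = 3" using 4 *(3) mod_mult_mult1[of 2 m' 4] by simp
      from mult_mod_eqI[OF this, of 3] have "u mod 4 = 1" unfolding u4 by simp
      hence "chi8 q0 = 1" using q8 * \<open>odd u\<close> by (simp add: chi4_def)
      hence "q0 mod 8 = 1 \<or> q0 mod 8 = 7" by (auto simp: chi8_def split: if_splits)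
      hence "q0 mod 8 = 1" using mod_4_eq_1_imp[OF q4] by auto
      thus ?thesis using 4 * by (simp add: q_def)
    qed
  qed
  moreover have "\<not> p dvd 3 * m \<and> QuadRes p (- (3 * int m))" if "prime p" "odd p" "p dvd q" for p
    using odd_dvd[OF that] ndvd QR that(1) by blast
  ultimately show ?thesis
    using \<open>q > 0\<close> \<open>coprime q m\<close> Leg by blast
qed

subsection \<open>The ternary form\<close>

text \<open>
  The form $(t(qx+by)+mz)^2+qx^2+2bxy+hy^2$ has determinant $3m^3$ and only takes multiples of $m$ as
  values, so Hermite's bound forces it to take the value $m$.
\<close>
lemma ternary_lattice_point:
  fixes m q b h t :: int
  assumes "m > 0" "q > 0" "coprime q m" and h: "q * h = b\<^sup>2 + 3 * m" and t: "m dvd t\<^sup>2 * q + 1"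
  shows "\<exists>R v X Y. m = R\<^sup>2 + v \<and> q * v = X\<^sup>2 + 3 * m * Y\<^sup>2"
proof -
  define A B C D E G where "A = t\<^sup>2 * q\<^sup>2 + q" and "B = t\<^sup>2 * b\<^sup>2 + h" and "C = m\<^sup>2"
    and "D = t\<^sup>2 * q * b + b" and "E = t * q * m" and "G = t * b * m"
  have form: "ternary_form A B C D E G x y z
      = (t * (q * x + b * y) + m * z)\<^sup>2 + (q * x\<^sup>2 + 2 * b * x * y + h * y\<^sup>2)" for x y z
    by (simp add: ternary_form_def A_def B_def C_def D_def E_def G_def power2_eq_square algebra_simps)
  have "A * B - D\<^sup>2 = (t\<^sup>2 * q + 1) * (q * h - b\<^sup>2)"
    by (simp add: A_def B_def D_def power2_eq_square algebra_simps)
  hence AB: "A * B - D\<^sup>2 = (t\<^sup>2 * q + 1) * (3 * m)" unfolding h by simp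
  have "ternary_det A B C D E G = m\<^sup>2 * (q * h - b\<^sup>2)"
    by (simp add: ternary_det_def A_def B_def C_def D_def E_def G_def power2_eq_square algebra_simps)
  hence det: "ternary_det A B C D E G = 3 * m ^ 3"
    unfolding h by (simp add: power2_eq_square power3_eq_cube)
  have tq: "t\<^sup>2 * q + 1 > 0" using assms(2) by (simp add: add_nonneg_pos)
  have pos: "A > 0" "A * B - D\<^sup>2 > 0" "ternary_det A B C D E G > 0"
  proof -
    have "A = q * (t\<^sup>2 * q + 1)" by (simp add: A_def power2_eq_square algebra_simps)
    thus "A > 0" using assms(2) tq by simp
  qed (unfold AB det, use assms(1) tq in auto)
  obtain x y z where xyz: "(x, y, z) \<noteq> (0, 0, 0)"
    "27 * ternary_form A B C D E G x y z ^ 3 \<le> 64 * (3 * m ^ 3)"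
    using ternary_form_Hermite[OF pos] unfolding det by blast
  define F where "F = ternary_form A B C D E G x y z"
  define R where "R = t * (q * x + b * y) + m * z"
  define v where "v = q * x\<^sup>2 + 2 * b * x * y + h * y\<^sup>2"
  have F: "F = R\<^sup>2 + v" unfolding F_def R_def v_def by (rule form)
  have "F > 0" unfolding F_def by (rule ternary_form_pos[OF pos xyz(1)])
  \<comment> \<open>Hermite's bound says F^3 <= (64/9) m^3, and 64/9 < 8.\<close>
  have "F < 2 * m"
  proof (rule ccontr)
    assume "\<not> ?thesis"
    hence "(2 * m) ^ 3 \<le> F ^ 3" using assms(1) by (intro power_mono) auto
    hence "8 * m ^ 3 \<le> F ^ 3" by (simp add: power_mult_distrib)
    moreover have "m ^ 3 > 0" using assms(1) by simp
    moreover have "27 * F ^ 3 \<le> 192 * m ^ 3" using xyz(2) by (simp add: F_def[symmetric])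
    ultimately show False by linarith
  qed
  have qv: "q * v = (q * x + b * y)\<^sup>2 + 3 * m * y\<^sup>2"
  proof -
    have "q * v = (q * x + b * y)\<^sup>2 + (q * h - b\<^sup>2) * y\<^sup>2"
      by (simp add: v_def power2_eq_square algebra_simps)
    thus ?thesis unfolding h by simp
  qed
  \<comment> \<open>Modulo m, q v is (q x + b y)^2, so q F is (t^2 q + 1) (q x + b y)^2, which is 0
    by the choice of t; and q is a unit modulo m.\<close>
  have "q * F = (t\<^sup>2 * q + 1) * (q * x + b * y)\<^sup>2
      + m * (q * (2 * t * (q * x + b * y) * z + m * z\<^sup>2) + 3 * y\<^sup>2)"
    unfolding F distrib_left qv R_def by (simp add: power2_eq_square algebra_simps)
  hence "m dvd q * F" using t by simp
  hence "m dvd F" using assms(3) by (simp add: coprime_dvd_mult_right_iff coprime_commute)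
  then obtain j where j: "F = m * j" by blast
  have "0 < j" using j \<open>F > 0\<close> assms(1) by (simp add: zero_less_mult_iff)
  moreover have "j < 2" using j \<open>F < 2 * m\<close> assms(1) by simp
  ultimately have "F = m" using j by simp
  thus ?thesis using F qv by blast
qed

section \<open>The parity of the valuations of v\<close>

lemma odd_square_mod_8:
  fixes x :: int
  assumes "odd x"
  shows "x\<^sup>2 mod 8 = 1"
proof -
  obtain k where k: "x = 2 * k + 1" using assms by (rule oddE)
  obtain j where "k * (k + 1) = 2 * j" using evenE[of "k * (k + 1)"] by auto
  moreover have "x\<^sup>2 = 4 * (k * (k + 1)) + 1" by (simp add: k power2_eq_square algebra_simps)
  ultimately have "x\<^sup>2 = 1 + 8 * j" by simp
  thus ?thesis by simp
qed

lemma even_square_mod_8: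
  fixes x :: int
  assumes "even x"
  shows "x\<^sup>2 mod 8 = 0 \<or> x\<^sup>2 mod 8 = 4"
proof -
  obtain k where k: "x = 2 * k" using assms by (rule evenE)
  hence x: "x\<^sup>2 = 4 * k\<^sup>2" by (simp add: power2_eq_square)
  show ?thesis
  proof (cases "even k")
    case True
    then obtain j where "k\<^sup>2 = 2 * j" by (metis evenE even_power zero_less_numeral)
    thus ?thesis using x by simp
  next
    case False
    then obtain j where "k\<^sup>2 = 2 * j + 1" by (metis oddE even_power)
    hence "x\<^sup>2 = 4 + 8 * j" using x by simp
    thus ?thesis by simp
  qed
qed

lemma multiplicity_2_eq_1:
  fixes v :: int
  assumes "v mod 4 = 2"
  shows "multiplicity 2 v = 1"
proof -
  have v: "v = 2 * (1 + 2 * (v div 4))"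
    using div_mult_mod_eq[of v 4] assms by simp
  have "\<not> 2 dvd 1 + 2 * (v div 4)" by simp
  hence "multiplicity 2 (1 + 2 * (v div 4)) = 0" by (rule not_dvd_imp_multiplicity_0)
  moreover have "multiplicity 2 (2 * (1 + 2 * (v div 4))) = 1 + multiplicity 2 (1 + 2 * (v div 4))"
    by (subst prime_elem_multiplicity_mult_distrib) (auto, presburger)
  ultimately show ?thesis using v by simp
qed

lemma norm_mod:
  fixes q v X m Y n :: int
  assumes "q * v = X\<^sup>2 + 3 * m * Y\<^sup>2"
  shows "((q mod n) * (v mod n)) mod n = (X\<^sup>2 mod n + (3 * (m mod n)) * (Y\<^sup>2 mod n)) mod n"
proof -
  have "((q mod n) * (v mod n)) mod n = (X\<^sup>2 + 3 * m * Y\<^sup>2) mod n"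
    unfolding mod_mult_eq assms ..
  also have "\<dots> = (X\<^sup>2 mod n + (3 * (m mod n)) * (Y\<^sup>2 mod n)) mod n"
  proof -
    have "[X\<^sup>2 + 3 * m * Y\<^sup>2 = X\<^sup>2 mod n + 3 * (m mod n) * (Y\<^sup>2 mod n)] (mod n)"
      by (intro cong_add cong_mult) (simp_all add: cong_def)
    thus ?thesis unfolding cong_def .
  qed
  finally show ?thesis .
qed

text \<open>Since 2 is inert, v/2 can be a norm only if v has odd valuation at 2. For m = 1 mod 8
  the norm q v has even valuation and q has valuation 1. In the other cases v = m - R^2 is either
  odd, which the class of q excludes modulo 4 or 8, or 2 mod 4.\<close>

lemma odd_multiplicity_2:
  fixes m q R v X Y :: int
  assumes mR: "m = R\<^sup>2 + v" and qv: "q * v = X\<^sup>2 + 3 * m * Y\<^sup>2" and "q > 0" "v \<noteq> 0"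
    and cases: "m mod 4 = 3 \<and> q mod 4 = 1 \<or> m mod 8 = 1 \<and> q mod 4 = 2 \<or> m mod 8 = 2 \<and> q mod 8 = 5
          \<or> m mod 8 = 6 \<and> q mod 8 = 1"
  shows "odd (multiplicity 2 v)"
proof -
  have sq: "x\<^sup>2 mod 8 = 0 \<or> x\<^sup>2 mod 8 = 1 \<or> x\<^sup>2 mod 8 = 4" for x :: int
    using odd_square_mod_8[of x] even_square_mod_8[of x] by blast
  have to4: "x mod 4 = x mod 8 mod 4" for x :: int
    by (simp add: mod_mod_cancel)
  have v8: "v mod 8 = (m mod 8 - R\<^sup>2 mod 8) mod 8" and v4: "v mod 4 = (m mod 4 - R\<^sup>2 mod 4) mod 4"
    using mR by (simp_all add: mod_diff_eq)
  have nonzero: "X\<^sup>2 + 3 * m * Y\<^sup>2 \<noteq> 0" unfolding qv[symmetric] using assms(3,4) by simp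
  consider (a) "m mod 4 = 3" "q mod 4 = 1" | (b) "m mod 8 = 1" "q mod 4 = 2"
    | (c) "m mod 8 = 2" "q mod 8 = 5" | (d) "m mod 8 = 6" "q mod 8 = 1"
    using cases by blast
  thus ?thesis
  proof cases
    case a
    have sq4: "x\<^sup>2 mod 4 = 0 \<or> x\<^sup>2 mod 4 = 1" for x :: int
      using sq[of x] to4[of "x\<^sup>2"] by auto
    have "(v mod 4) mod 4 = (X\<^sup>2 mod 4 + 9 * (Y\<^sup>2 mod 4)) mod 4"
      using norm_mod[OF qv, of 4] a by simp
    hence "v mod 4 \<noteq> 3" using sq4[of X] sq4[of Y] by auto
    hence "v mod 4 = 2" using v4 a sq4[of R] by auto
    thus ?thesis by (simp add: multiplicity_2_eq_1)
  next
    case b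
    have "even (multiplicity 2 (X\<^sup>2 + (3 * m) * Y\<^sup>2))"
    proof (rule multiplicity_norm_even)
      fix X Y :: int
      assume even: "2 dvd X\<^sup>2 + 3 * m * Y\<^sup>2"
      have "odd m" using b(1) dvd_mod_iff[of 2 8 m] by auto
      show "2 dvd X \<and> 2 dvd Y \<or> even (multiplicity 2 (X\<^sup>2 + 3 * m * Y\<^sup>2))"
      proof (cases "2 dvd X \<and> 2 dvd Y")
        case False
        \<comment> \<open>Odd squares are 1 mod 8, so the norm is 1 + 3 = 4 mod 8 and has valuation
          exactly 2.\<close>
        hence "odd X" "odd Y" using even \<open>odd m\<close> by auto
        define N where "N = X\<^sup>2 + 3 * m * Y\<^sup>2"
        have "(N mod 8) mod 8 = 4"
          using norm_mod[of 1 N X m Y 8] b(1) odd_square_mod_8[OF \<open>odd X\<close>] odd_square_mod_8[OF \<open>odd Y\<close>]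
          by (simp add: N_def)
        hence N8: "N mod 8 = 4" by simp
        have N: "N = 2\<^sup>2 * (1 + 2 * (N div 8))"
          using div_mult_mod_eq[of N 8] N8 by simp
        have "\<not> 2 dvd 1 + 2 * (N div 8)" by simp
        hence "multiplicity 2 (1 + 2 * (N div 8)) = 0" by (rule not_dvd_imp_multiplicity_0)
        moreover have "multiplicity 2 ((2::int)\<^sup>2) = 2" by (rule multiplicity_same_power) auto
        moreover have "1 + 2 * (N div 8) \<noteq> 0" using \<open>\<not> 2 dvd 1 + 2 * (N div 8)\<close> by (metis dvd_0_right)
        hence "multiplicity 2 (2\<^sup>2 * (1 + 2 * (N div 8)))
            = multiplicity 2 ((2::int)\<^sup>2) + multiplicity 2 (1 + 2 * (N div 8))"
          by (intro prime_elem_multiplicity_mult_distrib) auto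
        ultimately have "multiplicity 2 N = 2" using N by simp
        thus ?thesis by (simp add: N_def)
      qed auto
    qed (use nonzero in auto)
    hence "even (multiplicity 2 (q * v))" unfolding qv .
    moreover have "multiplicity 2 (q * v) = multiplicity 2 q + multiplicity 2 v"
      using assms(3,4) by (intro prime_elem_multiplicity_mult_distrib) auto
    ultimately show ?thesis using multiplicity_2_eq_1[OF b(2)] by simp
  next
    case c
    have "v mod 8 \<noteq> 1"
    proof
      assume v: "v mod 8 = 1"
      have "(5 * 1) mod 8 = (X\<^sup>2 mod 8 + 3 * 2 * (Y\<^sup>2 mod 8)) mod 8"
        using norm_mod[OF qv, of 8] by (simp only: c v)
      thus False using sq[of X] sq[of Y] by (elim disjE) (simp_all only:, simp_all)
    qed
    moreover have "((2 - R\<^sup>2 mod 8) mod 8 = 1 \<or> (2 - R\<^sup>2 mod 8) mod 8 = 2 \<or> (2 - R\<^sup>2 mod 8) mod 8 = (6::int))"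
      using sq[of R] by (elim disjE) (simp_all only:, simp_all)
    ultimately have "v mod 8 = 2 \<or> v mod 8 = 6" unfolding v8 c by blast
    hence "v mod 8 mod 4 = 2" by (elim disjE) (simp_all only:, simp_all)
    hence "v mod 4 = 2" by (simp only: to4[of v])
    thus ?thesis by (simp add: multiplicity_2_eq_1)
  next
    case d
    have "v mod 8 \<noteq> 5"
    proof
      assume v: "v mod 8 = 5"
      have "(1 * 5) mod 8 = (X\<^sup>2 mod 8 + 3 * 6 * (Y\<^sup>2 mod 8)) mod 8"
        using norm_mod[OF qv, of 8] by (simp only: d v)
      thus False using sq[of X] sq[of Y] by (elim disjE) (simp_all only:, simp_all)
    qed
    moreover have "((6 - R\<^sup>2 mod 8) mod 8 = 5 \<or> (6 - R\<^sup>2 mod 8) mod 8 = 2 \<or> (6 - R\<^sup>2 mod 8) mod 8 = (6::int))"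
      using sq[of R] by (elim disjE) (simp_all only:, simp_all)
    ultimately have "v mod 8 = 2 \<or> v mod 8 = 6" unfolding v8 d by blast
    hence "v mod 8 mod 4 = 2" by (elim disjE) (simp_all only:, simp_all)
    hence "v mod 4 = 2" by (simp only: to4[of v])
    thus ?thesis by (simp add: multiplicity_2_eq_1)
  qed
qed

text \<open>If p does not divide m, both -3m and m = R^2 are residues modulo p, hence so is -3. If p
  divides m, it divides R and X as well; dividing the norm equation by p^2 and reducing modulo p
  gives -q = -3 Y^2, and (-q/p) = 1 by the choice of q.\<close>

lemma odd_multiplicity_imp_QuadRes_minus_3:
  fixes m q p :: nat and R v X Y :: int
  assumes "squarefree m" "q > 0" "v \<noteq> 0" and p: "prime p" "odd p" "p \<noteq> 3" "odd (multiplicity (int p) v)"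
    and mR: "int m = R\<^sup>2 + v" and qv: "int q * v = X\<^sup>2 + 3 * int m * Y\<^sup>2"
    and "coprime q m"
    and pq: "p dvd q \<Longrightarrow> \<not> p dvd 3 * m \<and> QuadRes p (- (3 * int m))"
    and pm: "p dvd m \<Longrightarrow> Legendre (- int q) p = 1"
  shows "QuadRes p (-3)"
proof -
  have p2: "p > 2" using p(1,2) prime_ge_2_nat[of p] by (cases "p = 2") auto
  have pi: "prime (int p)" using p(1) by simp
  have n3: "\<not> p dvd 3" using p(1,3) primes_dvd_imp_eq[of p 3] by auto
  hence n3i: "\<not> int p dvd 3" by (metis int_dvd_int_iff of_nat_numeral)
  have pv: "int p dvd v" using p(4) not_dvd_imp_multiplicity_0[of "int p" v] by fastforce
  have "Legendre (-3) p = 1"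
  proof (cases "p dvd m")
    case False
    hence nm: "\<not> int p dvd int m" by simp
    hence n3m: "\<not> int p dvd 3 * int m" using n3i prime_dvd_mult_iff[OF pi] by blast
    have "QuadRes p (- (3 * int m))"
    proof (cases "p dvd q")
      case True
      thus ?thesis using pq by blast
    next
      case pq': False
      show ?thesis
      proof (rule ccontr)
        \<comment> \<open>For a nonresidue -3m the prime p is inert, so the norm q v has even
          valuation at p, against \<open>p(4)\<close>.\<close>
        assume nQ: "\<not> ?thesis"
        have "multiplicity (int p) (int q * v) = multiplicity (int p) (int q) + multiplicity (int p) v"
          using assms(2,3) pi by (intro prime_elem_multiplicity_mult_distrib) auto
        moreover have "multiplicity (int p) (int q) = 0"
          using pq' by (intro not_dvd_imp_multiplicity_0) simp
        moreover have "even (multiplicity (int p) (X\<^sup>2 + (3 * int m) * Y\<^sup>2))"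
        proof (rule multiplicity_norm_even[OF pi])
          fix X Y :: int
          assume d: "int p dvd X\<^sup>2 + 3 * int m * Y\<^sup>2"
          have "int p dvd Y" using QuadRes_if_dvd_norm[OF pi d] nQ by blast
          moreover from this have "int p dvd 3 * int m * Y\<^sup>2" by (simp add: power2_eq_square)
          hence "int p dvd X\<^sup>2" using d dvd_add_left_iff by blast
          hence "int p dvd X" using pi prime_dvd_power by blast
          ultimately show "int p dvd X \<and> int p dvd Y \<or> even (multiplicity (int p) (X\<^sup>2 + 3 * int m * Y\<^sup>2))"
            by blast
        qed (use qv assms(2,3) in \<open>simp flip: qv\<close>)
        ultimately show False using p(4) qv by simp
      qed
    qed
    hence L1: "Legendre (- (3 * int m)) p = 1" using n3m by (intro QuadRes_imp_Legendre) auto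
    have "[R\<^sup>2 = int m] (mod int p)" using pv mR by (simp add: cong_iff_dvd_diff)
    hence "QuadRes p m" unfolding QuadRes_def by blast
    hence L2: "Legendre m p = 1" using nm by (intro QuadRes_imp_Legendre) auto
    have "Legendre (-3 * int m) p = Legendre (-3) p * Legendre (int m) p" by (rule Legendre_mult[OF p(1) p2])
    thus ?thesis using L1 L2 by simp
  next
    case True
    then obtain m1 where m1: "m = p * m1" by blast
    have "\<not> p dvd m1"
    proof
      assume "p dvd m1"
      hence "p\<^sup>2 dvd m" unfolding m1 power2_eq_square by simp
      thus False using squarefreeD[OF assms(1)] p(1) not_prime_unit by blast
    qed
    hence nm1: "\<not> int p dvd int m1" by simp
    have "int p dvd int m" using True by simp
    hence "int p dvd R\<^sup>2" using mR pv by (metis dvd_add_left_iff)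
    hence "int p dvd R" using pi prime_dvd_power by blast
    then obtain R1 where R1: "R = int p * R1" by blast
    have "int p dvd X\<^sup>2"
    proof -
      have "X\<^sup>2 = int q * v - 3 * int m * Y\<^sup>2" using qv by simp
      thus ?thesis using pv \<open>int p dvd int m\<close> by simp
    qed
    hence "int p dvd X" using pi prime_dvd_power by blast
    then obtain X1 where X1: "X = int p * X1" by blast
    have v: "v = int p * (int m1 - int p * R1\<^sup>2)"
      using mR by (simp add: m1 R1 power2_eq_square algebra_simps)
    have "int p * (int q * (int m1 - int p * R1\<^sup>2)) = int p * (int p * X1\<^sup>2 + 3 * int m1 * Y\<^sup>2)"
      using qv unfolding v m1 X1 by (simp add: power2_eq_square algebra_simps)
    hence "int q * (int m1 - int p * R1\<^sup>2) = int p * X1\<^sup>2 + 3 * int m1 * Y\<^sup>2"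
      using p2 by simp
    hence "int m1 * (int q - 3 * Y\<^sup>2) = int p * (X1\<^sup>2 + int q * R1\<^sup>2)"
      by (simp add: algebra_simps)
    hence "int p dvd int q - 3 * Y\<^sup>2"
      using nm1 prime_dvd_multD[OF pi] by (metis dvd_triv_left)
    hence c: "[- int q = -3 * Y\<^sup>2] (mod int p)"
      unfolding cong_iff_dvd_diff by (simp add: dvd_diff_commute)
    have "Legendre (-3 * Y\<^sup>2) p = 1" using pm[OF True] Legendre_cong[OF c] by simp
    hence L: "Legendre (-3) p * (Legendre Y p * Legendre Y p) = 1"
      unfolding power2_eq_square Legendre_mult[OF p(1) p2] .
    hence "\<not> int p dvd Y" using Legendre_eq_0_iff[of Y "int p"] by auto
    thus ?thesis using L Legendre_square[OF p(1) p2] by simp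
  qed
  thus ?thesis by (rule Legendre_eq_1_imp_QuadRes)
qed

subsection \<open>Universality\<close>

lemma norm_form_nonneg: "z\<^sup>2 + z * w + w\<^sup>2 \<ge> (0 :: int)"
proof -
  have "4 * (z\<^sup>2 + z * w + w\<^sup>2) = (2 * z + w)\<^sup>2 + 3 * w\<^sup>2"
    by (simp add: power2_eq_square algebra_simps)
  moreover have "\<dots> \<ge> 0" by simp
  ultimately have "0 \<le> 4 * (z\<^sup>2 + z * w + w\<^sup>2)" by (simp only:)
  thus ?thesis unfolding zero_le_mult_iff by auto
qed

definition Q_represents :: "int \<Rightarrow> bool" where
  "Q_represents n \<longleftrightarrow> (\<exists>x z w. n = x\<^sup>2 + 2 * (z\<^sup>2 + z * w + w\<^sup>2))"

lemma Q_represents_iff_loeschian: "Q_represents n \<longleftrightarrow> (\<exists>x l. loeschian l \<and> n = x\<^sup>2 + 2 * l)"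
  unfolding Q_represents_def loeschian_def by blast

lemma Q_represents_mult_square:
  assumes "Q_represents n"
  shows "Q_represents (n * s\<^sup>2)"
proof -
  obtain x l where "loeschian l" "n = x\<^sup>2 + 2 * l"
    using assms by (auto simp: Q_represents_iff_loeschian)
  hence "loeschian (l * s\<^sup>2)" "n * s\<^sup>2 = (x * s)\<^sup>2 + 2 * (l * s\<^sup>2)"
    using loeschian_mult loeschian_square by (auto simp: power_mult_distrib distrib_right)
  thus ?thesis unfolding Q_represents_iff_loeschian by blast
qed

lemma int_mod_eq_iff: "int x mod int n = int r \<longleftrightarrow> x mod n = r"
  unfolding zmod_int[symmetric] of_nat_eq_iff ..

lemma multiplicity_int:
  fixes p n :: nat
  assumes "prime p" "n > 0"
  shows "multiplicity (int p) (int n) = multiplicity p n"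
proof (rule multiplicity_eqI)
  show "int p ^ multiplicity p n dvd int n"
    by (metis int_dvd_int_iff multiplicity_dvd of_nat_power)
  have "\<not> p ^ Suc (multiplicity p n) dvd n"
    using assms by (subst power_dvd_iff_le_multiplicity) (auto dest: not_prime_unit)
  thus "\<not> int p ^ Suc (multiplicity p n) dvd int n"
    by (metis int_dvd_int_iff of_nat_power)
qed

text \<open>The primes of odd exponent in v/2 are all norms: 2 is not among them as v has odd
  valuation at 2, 3 is 1 + 1 + 1, and the others have (-3/p) = 1.\<close>

lemma Q_represents_squarefree:
  fixes m :: nat
  assumes "squarefree m" "m mod 8 = 1 \<or> m mod 8 = 2 \<or> m mod 8 = 3 \<or> m mod 8 = 6 \<or> m mod 8 = 7"
  shows "Q_represents (int m)"
\<comment> \<open>The only squarefree square is set aside, so that v cannot be 0.\<close>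
proof (cases "m = 1")
  case True
  have "(1::int) = 1\<^sup>2 + 2 * (0\<^sup>2 + 0 * 0 + 0\<^sup>2)" by simp
  hence "Q_represents 1" unfolding Q_represents_def by blast
  thus ?thesis using True by simp
next
  case False
  have "m > 0" using assms(2) by (cases m) auto
  from exists_auxiliary_q[OF assms] obtain q b h t where q: "q > 0" "coprime q m"
    "b\<^sup>2 + 3 * int m = int q * h" "int m dvd t\<^sup>2 * int q + 1"
    and pq: "\<And>p. prime p \<Longrightarrow> odd p \<Longrightarrow> p dvd q \<Longrightarrow> \<not> p dvd 3 * m \<and> QuadRes p (- (3 * int m))"
    and pm: "\<And>p. prime p \<Longrightarrow> odd p \<Longrightarrow> p dvd m \<Longrightarrow> Legendre (- int q) p = 1"
    and qm: "m mod 4 = 3 \<and> q mod 4 = 1 \<or> m mod 8 = 1 \<and> q mod 4 = 2 \<or> m mod 8 = 2 \<and> q mod 8 = 5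
          \<or> m mod 8 = 6 \<and> q mod 8 = 1"
    by blast
  obtain R v X Y where mR: "int m = R\<^sup>2 + v" and qv: "int q * v = X\<^sup>2 + 3 * int m * Y\<^sup>2"
    using ternary_lattice_point[of "int m" "int q" h b t] q \<open>m > 0\<close> by auto
  have "v \<noteq> 0"
  proof
    assume "v = 0"
    hence "int m = int ((nat \<bar>R\<bar>)\<^sup>2)" using mR by simp
    hence mm: "m = (nat \<bar>R\<bar>)\<^sup>2" by (simp only: of_nat_eq_iff)
    hence "nat \<bar>R\<bar> dvd 1" using squarefreeD[OF assms(1), of "nat \<bar>R\<bar>"] by simp
    hence "m = 1" unfolding mm by simp
    thus False using False by simp
  qed
  moreover have "int q * v \<ge> 0" unfolding qv by simp
  ultimately have "v > 0" using q(1) by (simp add: zero_le_mult_iff)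
  have qm': "int m mod 4 = 3 \<and> int q mod 4 = 1 \<or> int m mod 8 = 1 \<and> int q mod 4 = 2
      \<or> int m mod 8 = 2 \<and> int q mod 8 = 5 \<or> int m mod 8 = 6 \<and> int q mod 8 = 1"
    using qm int_mod_eq_iff[of m 4 3, unfolded of_nat_numeral] int_mod_eq_iff[of q 4 1, unfolded of_nat_numeral of_nat_1]
      int_mod_eq_iff[of m 8 1, unfolded of_nat_numeral of_nat_1] int_mod_eq_iff[of q 4 2, unfolded of_nat_numeral]
      int_mod_eq_iff[of m 8 2, unfolded of_nat_numeral] int_mod_eq_iff[of q 8 5, unfolded of_nat_numeral]
      int_mod_eq_iff[of m 8 6, unfolded of_nat_numeral] int_mod_eq_iff[of q 8 1, unfolded of_nat_numeral of_nat_1]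
    by blast
  have odd2: "odd (multiplicity 2 v)"
    using odd_multiplicity_2[OF mR qv _ \<open>v \<noteq> 0\<close> qm'] q(1) by simp
  hence "2 dvd v" using not_dvd_imp_multiplicity_0[of 2 v] by fastforce
  define n where "n = nat (v div 2)"
  have n: "v = 2 * int n" using \<open>2 dvd v\<close> \<open>v > 0\<close> by (auto simp: n_def)
  have "n > 0" using n \<open>v > 0\<close> by simp
  have "loeschian (int n)"
  proof (rule loeschianI[OF \<open>n > 0\<close>])
    fix p :: nat assume p: "prime p" "odd (multiplicity p n)"
    have mult: "multiplicity (int p) v = multiplicity (int p) 2 + multiplicity p n"
    proof -
      have "multiplicity (int p) v = multiplicity (int p) 2 + multiplicity (int p) (int n)"
        unfolding n using p(1) \<open>n > 0\<close> by (intro prime_elem_multiplicity_mult_distrib) auto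
      moreover have "multiplicity (int p) (int n) = multiplicity p n"
        by (rule multiplicity_int[OF p(1) \<open>n > 0\<close>])
      ultimately show ?thesis by simp
    qed
    have "odd p"
    proof
      assume "even p"
      hence "p = 2" using p(1) primes_dvd_imp_eq two_is_prime_nat by blast
      thus False using mult odd2 p(2) by simp
    qed
    hence "\<not> int p dvd 2" using p(1) prime_ge_2_nat[of p] by (auto dest!: zdvd_imp_le)
    hence odd_v: "odd (multiplicity (int p) v)"
      using mult p(2) by (simp add: not_dvd_imp_multiplicity_0)
    show "loeschian (int p)"
    proof (cases "p = 3")
      case True
      have "(3::int) = 1\<^sup>2 + 1 * 1 + 1\<^sup>2" by simp
      hence "loeschian 3" unfolding loeschian_def by blast
      thus ?thesis using True by simp
    next
      case False
      have "QuadRes p (-3)"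
        by (rule odd_multiplicity_imp_QuadRes_minus_3[OF assms(1) q(1) \<open>v \<noteq> 0\<close> p(1) \<open>odd p\<close> False
              odd_v mR qv q(2)]) (use pq pm p(1) \<open>odd p\<close> in auto)
      thus ?thesis using loeschian_prime p(1) \<open>odd p\<close> by simp
    qed
  qed
  thus ?thesis unfolding Q_represents_iff_loeschian using mR n by blast
qed

lemma squarefree_mod_8:
  fixes m :: nat
  assumes "squarefree m"
  shows "m mod 8 = 1 \<or> m mod 8 = 2 \<or> m mod 8 = 3 \<or> m mod 8 = 5 \<or> m mod 8 = 6 \<or> m mod 8 = 7"
proof -
  have "\<not> 4 dvd m"
    using squarefreeD[OF assms, of 2] by auto
  hence "m mod 8 mod 4 \<noteq> 0" by (simp add: mod_mod_cancel mod_eq_0_iff_dvd)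
  moreover have "m mod 8 \<in> {..<8}" by simp
  hence "m mod 8 \<in> {0,1,2,3,4,5,6,7}" by (auto simp: lessThan_nat_numeral lessThan_Suc)
  ultimately show ?thesis by auto
qed

text \<open>As 4 does not divide n, its square part is odd, so the squarefree part is congruent to n
  modulo 8.\<close>

lemma Q_represents_nat:
  fixes n :: nat
  assumes "n mod 8 = 1 \<or> n mod 8 = 2 \<or> n mod 8 = 3"
  shows "Q_represents (int n)"
proof -
  define m s where "m = squarefree_part n" and "s = square_part n"
  have n: "n = m * s\<^sup>2" unfolding m_def s_def by (rule squarefree_decompose)
  have "n mod 8 mod 4 \<noteq> 0" using assms by auto
  hence "\<not> 4 dvd n" by (simp add: mod_mod_cancel mod_eq_0_iff_dvd)
  have "odd s"
  proof
    assume "even s"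
    then obtain k where "s = 2 * k" by (rule evenE)
    hence "n = 4 * (m * k\<^sup>2)" unfolding n by (simp add: power2_eq_square)
    thus False using \<open>\<not> 4 dvd n\<close> by simp
  qed
  hence "(int s)\<^sup>2 mod 8 = 1" by (intro odd_square_mod_8) simp
  hence "s\<^sup>2 mod 8 = 1" using int_mod_eq_iff[of "s\<^sup>2" 8 1, unfolded of_nat_numeral of_nat_1 of_nat_power] by blast
  hence "n mod 8 = m mod 8" unfolding n using mult_mod_eqI[of "s\<^sup>2" 8 1 m] by simp
  hence "Q_represents (int m)"
    using assms by (intro Q_represents_squarefree) (auto simp: m_def)
  thus ?thesis using Q_represents_mult_square[of "int m" "int s"] unfolding n by simp
qed

lemma Q_represents_minus:
  fixes m k c :: nat
  assumes "m mod 8 = 5" "k mod 8 = c" "c = 2 \<or> c = 3 \<or> c = 4" "k \<le> m"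
  shows "Q_represents (int m - int k)"
proof -
  have "k = 8 * (k div 8) + c" "m = 8 * (m div 8) + 5"
    using assms div_mult_mod_eq[of k 8] div_mult_mod_eq[of m 8] by simp_all
  hence "m - k = (5 - c) + 8 * (m div 8 - k div 8)"
    using assms(3,4) by linarith
  moreover have "(5 - c + 8 * j) mod 8 = (5 - c) mod 8" for j by (rule mod_mult_self2)
  ultimately have "(m - k) mod 8 = (5 - c) mod 8" by simp
  hence "Q_represents (int (m - k))" using assms(3) by (intro Q_represents_nat) auto
  thus ?thesis using assms(4) by simp
qed

lemma represents_1_iff: "represents 1 b n \<longleftrightarrow> (\<exists>y. Q_represents (n - b * y\<^sup>2))"
proof
  assume "represents 1 b n"
  then obtain x y z w where "x\<^sup>2 + b * y\<^sup>2 + 2 * (z\<^sup>2 + z * w + w\<^sup>2) = n"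
    by (auto simp: represents_def f2_def)
  hence "n - b * y\<^sup>2 = x\<^sup>2 + 2 * (z\<^sup>2 + z * w + w\<^sup>2)" by simp
  thus "\<exists>y. Q_represents (n - b * y\<^sup>2)" unfolding Q_represents_def by blast
next
  assume "\<exists>y. Q_represents (n - b * y\<^sup>2)"
  then obtain x y z w where "n - b * y\<^sup>2 = x\<^sup>2 + 2 * (z\<^sup>2 + z * w + w\<^sup>2)"
    by (auto simp: Q_represents_def)
  hence "f2 1 b x y z w = n" by (simp add: f2_def)
  thus "represents 1 b n" unfolding represents_def by blast
qed

text \<open>From the class 5 the subtraction has to lead into 1, 2 or 3 mod 8: y = 1 does so for b =
  2, 3, 4, and y = 2 for b = 1 and b = 5.\<close>

lemma represents_squarefree:
  fixes b :: int and m :: nat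
  assumes b: "b = 1 \<or> b = 2 \<or> b = 3 \<or> b = 4 \<or> b = 5" and "squarefree m"
  shows "\<exists>y. Q_represents (int m - b * y\<^sup>2)"
proof (cases "m mod 8 = 5")
  case False
  hence "Q_represents (int m - b * 0\<^sup>2)"
    using squarefree_mod_8[OF assms(2)] Q_represents_squarefree[OF assms(2)] by auto
  thus ?thesis by blast
next
  case True
  have "m \<ge> 5" using mod_less_eq_dividend[of m 8] True by simp
  consider "b = 1 \<or> b = 4" | "b = 2" | "b = 3" | "b = 5" using b by blast
  thus ?thesis
  proof cases
    case 1
    show ?thesis
    proof (cases "b = 1")
      case True': True
      have "Q_represents (int m - int 4)"
        using True \<open>m \<ge> 5\<close> by (intro Q_represents_minus[of m 4 4]) auto
      thus ?thesis using True' by (intro exI[of _ 2]) simp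
    next
      case False
      have "Q_represents (int m - int 4)"
        using True \<open>m \<ge> 5\<close> by (intro Q_represents_minus[of m 4 4]) auto
      thus ?thesis using 1 False by (intro exI[of _ 1]) simp
    qed
  next
    case 2
    have "Q_represents (int m - int 2)"
      using True \<open>m \<ge> 5\<close> by (intro Q_represents_minus[of m 2 2]) auto
    thus ?thesis using 2 by (intro exI[of _ 1]) simp
  next
    case 3
    have "Q_represents (int m - int 3)"
      using True \<open>m \<ge> 5\<close> by (intro Q_represents_minus[of m 3 3]) auto
    thus ?thesis using 3 by (intro exI[of _ 1]) simp
  next
    case 4
    \<comment> \<open>Here y = 2 subtracts 20. The members 5 and 13 of the class are too small for
      that, but y = 1 leaves 0 and 8, which \<open>Q\<close> represents.\<close>
    consider "m = 5" | "m = 13" | "m \<ge> 20"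
    proof -
      have "m = 8 * (m div 8) + 5" using div_mult_mod_eq[of m 8] True by simp
      moreover have "m div 8 = 0 \<or> m div 8 = 1 \<or> m div 8 \<ge> 2" by linarith
      ultimately show thesis using that by linarith
    qed
    thus ?thesis
    proof cases
      case 1
      have "(0::int) = 0\<^sup>2 + 2 * (0\<^sup>2 + 0 * 0 + 0\<^sup>2)" by simp
      hence "Q_represents 0" unfolding Q_represents_def by blast
      thus ?thesis using 1 4 by (intro exI[of _ 1]) simp
    next
      case 2
      have "(8::int) = 0\<^sup>2 + 2 * (2\<^sup>2 + 2 * 0 + 0\<^sup>2)" by simp
      hence "Q_represents 8" unfolding Q_represents_def by blast
      thus ?thesis using 2 4 by (intro exI[of _ 1]) simp
    next
      case 3
      have "Q_represents (int m - int 20)"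
        using True 3 by (intro Q_represents_minus[of m 20 4]) auto
      thus ?thesis using 4 by (intro exI[of _ 2]) simp
    qed
  qed
qed

lemma int_square_cases: "x\<^sup>2 = 0 \<or> x\<^sup>2 = 1 \<or> x\<^sup>2 = 4 \<or> (x::int)\<^sup>2 \<ge> 9"
proof -
  have "\<bar>x\<bar> = 0 \<or> \<bar>x\<bar> = 1 \<or> \<bar>x\<bar> = 2 \<or> \<bar>x\<bar> \<ge> 3" by linarith
  moreover have "x\<^sup>2 \<ge> 9" if "\<bar>x\<bar> \<ge> 3" using power_mono[OF that, of 2] by simp
  moreover have "x\<^sup>2 = 4" if "\<bar>x\<bar> = 2" using power2_abs[of x] unfolding that by simp
  moreover have "x\<^sup>2 = 1" if "\<bar>x\<bar> = 1" using power2_abs[of x] unfolding that by simp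
  ultimately show ?thesis by auto
qed

text \<open>An even norm has both coordinates even and so is divisible by 4. This excludes 5 = x^2 +
  2N, whose only solution in integers N >= 0 would be N = 2.\<close>

lemma norm_form_neq_2: "z\<^sup>2 + z * w + w\<^sup>2 \<noteq> (2 :: int)"
proof
  assume 2: "z\<^sup>2 + z * w + w\<^sup>2 = 2"
  hence "even (z\<^sup>2 + z * w + w\<^sup>2)" by simp
  hence "even z" "even w" by auto
  then obtain i j where "z = 2 * i" "w = 2 * j" by (auto elim!: evenE)
  hence "4 * (i\<^sup>2 + i * j + j\<^sup>2) = 2" using 2 by (simp add: power2_eq_square algebra_simps)
  thus False by presburger
qed

theorem theorem4p2:
  fixes a b :: int
  assumes "0 < a" and "a \<le> b"
    and "represents a b 1" and "represents a b 5"
  shows "\<forall>n::int. n \<ge> 0 \<longrightarrow> represents a b n"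
proof -
  have pos: "c * x\<^sup>2 \<ge> c" if "x \<noteq> 0" "c > 0" for c x :: int
    using that int_square_cases[of x] mult_left_mono[of 1 "x\<^sup>2" c] by auto
  have "a = 1"
  proof (rule ccontr)
    assume "a \<noteq> 1"
    hence "a \<ge> 2" using assms(1) by linarith
    obtain x y z w where "a * x\<^sup>2 + b * y\<^sup>2 + 2 * (z\<^sup>2 + z * w + w\<^sup>2) = 1"
      using assms(3) by (auto simp: represents_def f2_def)
    then obtain N where eq: "a * x\<^sup>2 + b * y\<^sup>2 + 2 * N = 1" and "N \<ge> 0"
      using norm_form_nonneg by blast
    have nonneg: "a * x\<^sup>2 \<ge> 0" "b * y\<^sup>2 \<ge> 0" using assms(1,2) by auto
    have "\<not> a * x\<^sup>2 \<ge> a" "\<not> b * y\<^sup>2 \<ge> b"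
      using eq nonneg \<open>N \<ge> 0\<close> \<open>a \<ge> 2\<close> assms(2) by linarith+
    hence "x = 0" "y = 0" using pos[of x a] pos[of y b] assms(1,2) by auto
    hence "2 * N = 1" using eq by simp
    thus False by presburger
  qed
  have "b \<le> 5"
  proof -
    obtain x y z w where "x\<^sup>2 + b * y\<^sup>2 + 2 * (z\<^sup>2 + z * w + w\<^sup>2) = 5"
      using assms(4) \<open>a = 1\<close> by (auto simp: represents_def f2_def)
    then obtain N where eq: "x\<^sup>2 + b * y\<^sup>2 + 2 * N = 5" and N: "N \<ge> 0" "N \<noteq> 2"
      using norm_form_nonneg norm_form_neq_2 by blast
    have "y \<noteq> 0"
    proof
      assume "y = 0"
      hence "x\<^sup>2 + 2 * N = 5" using eq by simp
      thus False using int_square_cases[of x] N by presburger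
    qed
    hence "b * y\<^sup>2 \<ge> b" using pos assms(1,2) by simp
    moreover have "x\<^sup>2 \<ge> 0" by simp
    ultimately show ?thesis using eq N(1) by linarith
  qed
  hence b: "b = 1 \<or> b = 2 \<or> b = 3 \<or> b = 4 \<or> b = 5" using assms(2) \<open>a = 1\<close> by linarith
  show ?thesis
  proof (intro allI impI)
    fix n :: int assume "n \<ge> 0"
    \<comment> \<open>For n = 0 this still works: m is squarefree, hence nonzero, and s is
      0.\<close>
    define m s where "m = squarefree_part (nat n)" and "s = square_part (nat n)"
    have "nat n = m * s\<^sup>2" unfolding m_def s_def by (rule squarefree_decompose)
    hence n: "n = int m * (int s)\<^sup>2" using \<open>n \<ge> 0\<close> by (metis nat_0_le of_nat_mult of_nat_power)
    obtain y where "Q_represents (int m - b * y\<^sup>2)"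
      using represents_squarefree[OF b, of m] by (auto simp: m_def)
    hence "Q_represents ((int m - b * y\<^sup>2) * (int s)\<^sup>2)" by (rule Q_represents_mult_square)
    also have "(int m - b * y\<^sup>2) * (int s)\<^sup>2 = n - b * (y * int s)\<^sup>2"
      by (simp add: n power_mult_distrib algebra_simps)
    finally show "represents a b n" unfolding \<open>a = 1\<close> represents_1_iff by blast
  qed
qed

end
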